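(* Let $f\in{\cal N}_1$ have divisor $D=((a_n),(b_n))$. There is $C<\infty$ such that for all $c\in\mathbb{C}$ and all $r>1$, $$\Big|\int_1^r\frac{{\rm card}\{n:|a_n-c|<t\}-{\rm card}\{n:|b_n-c|<t\}}{t}\,dt\Big|<C,$$ and $$\Big|\frac1r\int_1^r\Big(\sum_{n:|a_n-c|<t}(a_n-c)-\sum_{n:|b_n-c|<t}(b_n-c)\Big)\frac{dt}{t}\Big|<C.$$
   Context: $\rho_S$ is the spherical metric. A meromorphic $f$ on $\mathbb{C}$ is normal if every sequence of translates $f(z+h_n)$ has a subsequence Cauchy in $\rho_S$ uniformly on compacta; $f\in{\cal N}_1$ if moreover no limit of translates is a constant function (including $\infty$). The divisor lists zeros $a_n$ and poles $b_n$ with multiplicity. *)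

theory Defs
  imports "HOL-Analysis.Analysis"
begin

text \<open>The Riemann sphere is modelled as complex option, None being the point at infinity.\<close>

fun rhoS :: "complex option \<Rightarrow> complex option \<Rightarrow> real" where
  "rhoS (Some z) (Some w) = 2 * cmod (z - w) / sqrt ((1 + (cmod z)\<^sup>2) * (1 + (cmod w)\<^sup>2))"
| "rhoS (Some z) None = 2 / sqrt (1 + (cmod z)\<^sup>2)"
| "rhoS None (Some w) = 2 / sqrt (1 + (cmod w)\<^sup>2)"
| "rhoS None None = 0"

definition local_rep :: "(complex \<Rightarrow> complex option) \<Rightarrow> complex \<Rightarrow> int \<Rightarrow> bool" where
  "local_rep f z0 m \<longleftrightarrow> (\<exists>r>0. \<exists>g. g holomorphic_on ball z0 r \<and> g z0 \<noteq> 0 \<and>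
      (\<forall>z\<in>ball z0 r. f z = (if z = z0 \<and> m < 0 then None else Some ((z - z0) powi m * g z))))"

text \<open>Meromorphic on the whole plane (not identically zero), values in the Riemann sphere.\<close>
definition meromorphic_C :: "(complex \<Rightarrow> complex option) \<Rightarrow> bool" where
  "meromorphic_C f \<longleftrightarrow> (\<forall>z0. \<exists>m. local_rep f z0 m)"

definition mord :: "(complex \<Rightarrow> complex option) \<Rightarrow> complex \<Rightarrow> int" where
  "mord f z0 = (THE m. local_rep f z0 m)"

definition normal_fn :: "(complex \<Rightarrow> complex option) \<Rightarrow> bool" where
  "normal_fn f \<longleftrightarrow> (\<forall>h :: nat \<Rightarrow> complex. \<exists>\<sigma>::nat \<Rightarrow> nat. strict_mono \<sigma> \<and>
     (\<forall>K. compact K \<longrightarrow> (\<forall>\<epsilon>>0. \<exists>N. \<forall>m\<ge>N. \<forall>n\<ge>N. \<forall>z\<in>K.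
        rhoS (f (z + h (\<sigma> m))) (f (z + h (\<sigma> n))) < \<epsilon>)))"

definition translates_converge ::
  "(complex \<Rightarrow> complex option) \<Rightarrow> (nat \<Rightarrow> complex) \<Rightarrow> (complex \<Rightarrow> complex option) \<Rightarrow> bool" where
  "translates_converge f h g \<longleftrightarrow> (\<forall>K. compact K \<longrightarrow> (\<forall>\<epsilon>>0. \<exists>N. \<forall>n\<ge>N. \<forall>z\<in>K.
        rhoS (f (z + h n)) (g z) < \<epsilon>))"

definition class_N1 :: "(complex \<Rightarrow> complex option) \<Rightarrow> bool" where
  "class_N1 f \<longleftrightarrow> meromorphic_C f \<and> normal_fn f \<and>
     \<not> (\<exists>h w. translates_converge f h (\<lambda>_. w))"

text \<open>Counting functions of the divisor: zeros a_n and poles b_n listed with multiplicity.\<close>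
definition zero_count :: "(complex \<Rightarrow> complex option) \<Rightarrow> complex \<Rightarrow> real \<Rightarrow> real" where
  "zero_count f c t = real (\<Sum>z\<in>{z. cmod (z - c) < t \<and> f z = Some 0}. nat (mord f z))"

definition pole_count :: "(complex \<Rightarrow> complex option) \<Rightarrow> complex \<Rightarrow> real \<Rightarrow> real" where
  "pole_count f c t = real (\<Sum>z\<in>{z. cmod (z - c) < t \<and> f z = None}. nat (- mord f z))"

definition zero_sum :: "(complex \<Rightarrow> complex option) \<Rightarrow> complex \<Rightarrow> real \<Rightarrow> complex" where
  "zero_sum f c t = (\<Sum>z\<in>{z. cmod (z - c) < t \<and> f z = Some 0}. of_nat (nat (mord f z)) * (z - c))"

definition pole_sum :: "(complex \<Rightarrow> complex option) \<Rightarrow> complex \<Rightarrow> real \<Rightarrow> complex" where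
  "pole_sum f c t = (\<Sum>z\<in>{z. cmod (z - c) < t \<and> f z = None}. of_nat (nat (- mord f z)) * (z - c))"

end

(* Jensen's formula turns the first integral into U r - U 1, where U t is the mean of log|f| over the
   circle of radius t about c. If M t is 1/pi times the integral of log|f| e^(i theta) over that circle, then
   the second integral is (r * M r - M 1) / 2 minus the integral of M over [1, r].
   So it suffices to bound U and M uniformly in c and t >= 1, and this follows once the integral
   of |log|f|| over circles of radius >= 1 is bounded in the angular variable.

   Normality makes f uniformly continuous for the spherical metric, so that on every disc of some fixed
   radius f or 1/f is bounded by 2. As no limit of translates is constant, that function is also bounded
   away from 0 somewhere near the centre. Hence it is a product of boundedly many linear
   factors and a zero-free function whose logarithm is bounded by Harnack's inequality, so log|f| is a
   bounded number of terms log|z - a| up to O(1). On a circular arc of length at most 1 each of these terms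
   has a bounded integral. *)
theory Submission
  imports Defs "HOL-Complex_Analysis.Complex_Analysis"
begin

subsection \<open>Circle means of harmonic functions and of log|z - b|\<close>

text \<open>The centre \<open>c\<close> may itself be a zero or a pole, so no value of log|f| at
  \<open>c\<close> can anchor Jensen's formula. The zero-free factor of f on a disc contributes a
  constant p to U and a linear term t q to M, both depending on the disc. The expressions in U and M
  are chosen so that p cancels in the difference and t q cancels between the endpoint terms and the
  integral of M.

  A circle of radius t meets a number of discs of fixed size that grows like t, and each may carry
  several logarithmic singularities. The bound survives because integration is in the angle: an arc
  of fixed length has angle of order 1/t, and each singularity contributes at most a multiple of
  that angle.

  Excluding constant limits is a statement about sequences and yields at first only some large
  radius within which f must leave a neighbourhood of 0. Montel's theorem and the identity theorem
  bring this down to the small radius on which f or 1/f is bounded.\<close>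

lemma mean_value_circle:
  assumes h: "h holomorphic_on ball 0 R" and t: "0 < t" "t < R"
  shows "((\<lambda>\<theta>. h (of_real t * cis \<theta>)) has_integral (2 * of_real pi * h 0)) {0..2*pi}"
proof -
  have "h holomorphic_on cball 0 t"
    by (rule holomorphic_on_subset[OF h]) (use t in auto)
  then have "((\<lambda>u. h u / (u - 0)) has_contour_integral (2 * of_real pi * \<i> * h 0)) (circlepath 0 t)"
    using t by (intro Cauchy_integral_circlepath_simple) auto
  then have "((\<lambda>\<theta>. h (of_real t * cis \<theta>) / (of_real t * cis \<theta>) * of_real t * \<i> * cis \<theta>)
      has_integral (2 * of_real pi * \<i> * h 0)) {0..2*pi}"
    unfolding circlepath_def by (subst (asm) has_contour_integral_part_circlepath_iff) auto
  also have "(\<lambda>\<theta>. h (of_real t * cis \<theta>) / (of_real t * cis \<theta>) * of_real t * \<i> * cis \<theta>) =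
      (\<lambda>\<theta>. \<i> * h (of_real t * cis \<theta>))"
    using t by (intro ext) simp
  finally have "((\<lambda>\<theta>. - \<i> * (\<i> * h (of_real t * cis \<theta>))) has_integral - \<i> * (2 * of_real pi * \<i> * h 0)) {0..2*pi}"
    by (rule has_integral_mult_right)
  moreover have "- \<i> * (\<i> * x) = x" for x by simp
  moreover have "- \<i> * (2 * of_real pi * \<i> * h 0) = 2 * of_real pi * h 0" by simp
  ultimately show ?thesis by (simp only:)
qed

lemma has_integral_cnjI:
  "((\<lambda>x. cnj (f x)) has_integral cnj I) S" if "(f has_integral I) S" for f :: "real \<Rightarrow> complex"
  using has_integral_linear[OF that bounded_linear_cnj] by (simp add: o_def)

lemma Re_mean_circle:
  assumes h: "h holomorphic_on ball 0 R" and t: "0 < t" "t < R"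
  shows "((\<lambda>\<theta>. Re (h (of_real t * cis \<theta>))) has_integral (2 * pi * Re (h 0))) {0..2*pi}"
  using has_integral_linear[OF mean_value_circle[OF assms] bounded_linear_Re] by (simp add: o_def)

text \<open>Since Re h = (h + cnj h) / 2, it suffices to treat h and cnj h. The moment of h vanishes
  because u h(u) is zero at the centre. That of cnj h is the conjugate of the Fourier coefficient
  belonging to h'(0), which is the mean value of the holomorphic difference quotient of h at
  0.\<close>

lemma Re_moment_circle:
  assumes h: "h holomorphic_on ball 0 R" and t: "0 < t" "t < R"
  shows "((\<lambda>\<theta>. of_real (Re (h (of_real t * cis \<theta>))) * cis \<theta>) has_integral
           (of_real pi * of_real t * cnj (deriv h 0))) {0..2*pi}"
proof -
  have up: "((\<lambda>\<theta>. g (of_real t * cis \<theta>) * cis \<theta>) has_integral 0) {0..2*pi}"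
    if g: "g holomorphic_on ball 0 R" for g
  proof -
    have "(\<lambda>u. g u * u) holomorphic_on ball 0 R"
      using g by (intro holomorphic_intros)
    from has_integral_mult_right[OF mean_value_circle[OF this t], of "inverse (of_real t)"]
    have "((\<lambda>\<theta>. inverse (of_real t) * (g (of_real t * cis \<theta>) * (of_real t * cis \<theta>))) has_integral 0) {0..2*pi}"
      by simp
    moreover have "inverse (of_real t) * (g (of_real t * cis \<theta>) * (of_real t * cis \<theta>)) = g (of_real t * cis \<theta>) * cis \<theta>" for \<theta>
      using t by simp
    ultimately show ?thesis by (simp only:)
  qed
  let ?k = "\<lambda>z. if z = 0 then deriv h 0 else (h z - h 0) / (z - 0)"
  have "?k holomorphic_on ball 0 R"
    using t by (intro pole_lemma h) auto
  from has_integral_mult_right[OF mean_value_circle[OF this t], of "of_real t"]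
  have "((\<lambda>\<theta>. of_real t * (if of_real t * cis \<theta> = 0 then deriv h 0
      else (h (of_real t * cis \<theta>) - h 0) / (of_real t * cis \<theta> - 0)))
      has_integral (of_real t * (2 * of_real pi * deriv h 0))) {0..2*pi}" by simp
  moreover have "of_real t * (if of_real t * cis \<theta> = 0 then deriv h 0
      else (h (of_real t * cis \<theta>) - h 0) / (of_real t * cis \<theta> - 0)) = (h (of_real t * cis \<theta>) - h 0) * cnj (cis \<theta>)" for \<theta>
    using t by (simp add: divide_inverse cis_cnj mult_ac)
  ultimately have "((\<lambda>\<theta>. (h (of_real t * cis \<theta>) - h 0) * cnj (cis \<theta>)) has_integral (of_real t * (2 * of_real pi * deriv h 0))) {0..2*pi}"
    by (simp only:)
  moreover have "((\<lambda>\<theta>. h 0 * cnj (cis \<theta>)) has_integral 0) {0..2*pi}"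
    using has_integral_mult_right[OF has_integral_cnjI[OF up[of "\<lambda>_. 1"]], of "h 0"] by simp
  ultimately have "((\<lambda>\<theta>. (h (of_real t * cis \<theta>) - h 0) * cnj (cis \<theta>) + h 0 * cnj (cis \<theta>)) has_integral
      (of_real t * (2 * of_real pi * deriv h 0) + 0)) {0..2*pi}"
    by (rule has_integral_add)
  then have "((\<lambda>\<theta>. h (of_real t * cis \<theta>) * cnj (cis \<theta>)) has_integral (of_real t * (2 * of_real pi * deriv h 0))) {0..2*pi}"
    by (simp only: left_diff_distrib diff_add_cancel add_0_right)
  from has_integral_add[OF up[OF h] has_integral_cnjI[OF this]]
  have "((\<lambda>\<theta>. (h (of_real t * cis \<theta>) + cnj (h (of_real t * cis \<theta>))) * cis \<theta>) has_integral
           (of_real t * (2 * of_real pi * cnj (deriv h 0)))) {0..2*pi}"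
    by (simp add: distrib_right)
  from has_integral_mult_right[OF this, of "1/2"] show ?thesis
    by (simp add: complex_add_cnj mult.assoc mult.left_commute)
qed

text \<open>A zero \<open>b\<close> inside the circle is replaced by its mirror image
  \<open>t^2 / cnj b\<close>, so that both integrals follow from the mean and the moment of one
  holomorphic logarithm. The maximum merges the inner and the outer case; circles through
  \<open>b\<close> are left out and enter later by continuity in the radius.\<close>

lemma ln_norm_circle:
  assumes t: "0 < t" and bt: "cmod b \<noteq> t"
  shows "((\<lambda>\<theta>. ln (cmod (of_real t * cis \<theta> - b))) has_integral (2 * pi * ln (max t (cmod b)))) {0..2*pi}"
    and "((\<lambda>\<theta>. of_real (ln (cmod (of_real t * cis \<theta> - b))) * cis \<theta>) has_integral
           (- of_real pi * (b * of_real t / of_real ((max t (cmod b))\<^sup>2)))) {0..2*pi}"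
proof -
  \<comment> \<open>On the circle \<open>|z| = t\<close> one has \<open>|z - b| = max t |b| * |1 - d z|\<close> with \<open>|d| < 1 / t\<close>, also when \<open>b\<close> lies inside it.\<close>
  have "\<exists>h R. h holomorphic_on ball 0 R \<and> t < R \<and> Re (h 0) = ln (max t (cmod b)) \<and>
         deriv h 0 = - (cnj b / of_real ((max t (cmod b))\<^sup>2)) \<and>
         (\<forall>\<theta>. ln (cmod (of_real t * cis \<theta> - b)) = Re (h (of_real t * cis \<theta>)))"
  proof -
    define d where "d = cnj b / of_real ((max t (cmod b))\<^sup>2)"
    define h where "h = (\<lambda>z. of_real (ln (max t (cmod b))) + Ln (1 - d * z))"
    \<comment> \<open>For b \<noteq> 0 the radius is 1/|d|, the modulus of the zero of 1 - d z. It
      exceeds t because |b| \<noteq> t.\<close>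
    obtain R where R: "t < R" "cmod d * R \<le> 1"
    proof (cases "b = 0")
      case True
      then show ?thesis using that[of "t+1"] by (simp add: d_def)
    next
      case False
      have "cmod d = cmod b / (max t (cmod b))\<^sup>2"
        by (simp add: d_def norm_divide norm_power)
      moreover have "t * cmod b < (max t (cmod b))\<^sup>2"
      proof (cases "cmod b < t")
        case True
        then show ?thesis using t by (simp add: max_def power2_eq_square)
      next
        case f: False
        then have "t < cmod b" using bt by simp
        then show ?thesis using t False by (simp add: max_def power2_eq_square)
      qed
      ultimately show ?thesis using that[of "(max t (cmod b))\<^sup>2 / cmod b"] False t
        by (simp add: field_simps)
    qed
    have lt: "cmod (d * z) < 1" if "cmod z < R" for z
    proof (cases "d = 0")
      case False
      then have "cmod d * cmod z < cmod d * R" using that by simp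
      then show ?thesis using R by (simp add: norm_mult)
    qed simp
    have nonpos: "1 - d * z \<notin> \<real>\<^sub>\<le>\<^sub>0" if "cmod z < R" for z
    proof -
      have "Re (d * z) < 1" using lt[OF that] abs_Re_le_cmod[of "d*z"] by linarith
      then show ?thesis by (auto simp: complex_nonpos_Reals_iff)
    qed
    have hol: "h holomorphic_on ball 0 R"
      unfolding h_def by (intro holomorphic_intros) (use nonpos in auto)
    have "(h has_field_derivative - d) (at 0)"
      unfolding h_def by (auto intro!: derivative_eq_intros)
    then have der: "deriv h 0 = - d" by (rule DERIV_imp_deriv)
    have "ln (cmod (of_real t * cis \<theta> - b)) = Re (h (of_real t * cis \<theta>))" for \<theta>
    proof -
      let ?z = "of_real t * cis \<theta>"
      have z: "cmod ?z = t" using t by (simp add: norm_mult)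
      then have nz: "1 - d * ?z \<noteq> 0" using nonpos[of ?z] R by auto
      have pos: "max t (cmod b) > 0" using t by simp
      have eq: "cmod (?z - b) = max t (cmod b) * cmod (1 - d * ?z)"
      proof (cases "cmod b < t")
        case True
        have "cmod (?z - b) = cmod (cnj (cis \<theta>) * (?z - b))" by (simp add: norm_mult)
        also have "cnj (cis \<theta>) * (?z - b) = of_real t - b * cnj (cis \<theta>)"
          by (simp add: algebra_simps cis_cnj cis_mult)
        also have "cmod \<dots> = cmod (cnj (of_real t - b * cnj (cis \<theta>)))" by (simp only: complex_mod_cnj)
        also have "cnj (of_real t - b * cnj (cis \<theta>)) = of_real t - cnj b * cis \<theta>" by simp
        also have "cnj b = of_real t * d * of_real t"
          using t True by (simp add: d_def max_def power2_eq_square)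
        also have "of_real t - of_real t * d * of_real t * cis \<theta> = of_real t * (1 - d * ?z)"
          by (simp add: right_diff_distrib mult_ac)
        finally show ?thesis using t True by (simp add: norm_mult)
      next
        case False
        then have b: "t < cmod b" using bt by simp
        have "d = 1 / b"
          using b t by (simp add: d_def max_def complex_norm_square del: of_real_power)
        moreover have "b \<noteq> 0" using b t by auto
        ultimately have "?z - b = - b * (1 - d * ?z)" by (simp add: field_simps)
        then show ?thesis using b by (simp add: norm_mult)
      qed
      show ?thesis using eq pos nz by (simp add: h_def ln_mult)
    qed
    moreover have "Re (h 0) = ln (max t (cmod b))" by (simp add: h_def)
    ultimately show ?thesis using hol R(1) der[unfolded d_def] by (intro exI[of _ h] exI[of _ R] conjI allI)
  qed
  then obtain h R where h: "h holomorphic_on ball 0 R" "t < R" "Re (h 0) = ln (max t (cmod b))"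
     "deriv h 0 = - (cnj b / of_real ((max t (cmod b))\<^sup>2))"
     "\<And>\<theta>. ln (cmod (of_real t * cis \<theta> - b)) = Re (h (of_real t * cis \<theta>))"
    by blast
  show "((\<lambda>\<theta>. ln (cmod (of_real t * cis \<theta> - b))) has_integral (2 * pi * ln (max t (cmod b)))) {0..2*pi}"
    using Re_mean_circle[OF h(1) t h(2)] by (simp add: h(3,5))
  show "((\<lambda>\<theta>. of_real (ln (cmod (of_real t * cis \<theta> - b))) * cis \<theta>) has_integral
           (- of_real pi * (b * of_real t / of_real ((max t (cmod b))\<^sup>2)))) {0..2*pi}"
    using Re_moment_circle[OF h(1) t h(2)] unfolding h(4,5) by (simp add: mult_ac)
qed

subsection \<open>The spherical metric and inversion\<close>

text \<open>The Riemann sphere becomes the unit sphere of \<open>complex \<times> real\<close> with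
  infinity as north pole. There \<open>rhoS\<close> is the length of a chord, which is the source of
  its triangle inequality.\<close>

definition stereo :: "complex option \<Rightarrow> complex \<times> real" where
  "stereo x = (case x of None \<Rightarrow> (0, 1)
     | Some z \<Rightarrow> (of_real (2 / (1 + (cmod z)\<^sup>2)) * z, 1 - 2 / (1 + (cmod z)\<^sup>2)))"

lemma rhoS_eq_dist: "rhoS x y = dist (stereo x) (stereo y)"
proof -
  have pos: "1 + (cmod z)\<^sup>2 > 0" for z
    by (simp add: add_pos_nonneg)
  have one: "dist (stereo (Some z)) (stereo None) = 2 / sqrt (1 + (cmod z)\<^sup>2)" for z
  proof -
    define Z where "Z = 1 + (cmod z)\<^sup>2"
    have "(2 / Z)\<^sup>2 * (Z - 1) + (2 / Z)\<^sup>2 = 4 / Z"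
    proof -
      have "Z \<noteq> 0" using pos[of z] by (simp add: Z_def)
      then show ?thesis by (simp add: divide_simps power2_eq_square)
    qed
    then have "(2 / Z * cmod z)\<^sup>2 + (2 / Z)\<^sup>2 = 4 / Z"
      by (simp only: power_mult_distrib) (simp add: Z_def)
    moreover have "dist (stereo (Some z)) (stereo None) = sqrt ((2 / Z * cmod z)\<^sup>2 + (2 / Z)\<^sup>2)"
    proof -
      have "dist (of_real (2 / Z) * z) 0 = 2 / Z * cmod z" "dist (1 - 2 / Z) 1 = 2 / Z"
        using pos[of z] by (simp_all add: Z_def[symmetric] dist_norm norm_mult norm_divide)
      then show ?thesis by (simp only: stereo_def option.case dist_Pair_Pair Z_def)
    qed
    ultimately show ?thesis by (simp add: real_sqrt_divide Z_def)
  qed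
  have two: "dist (stereo (Some z)) (stereo (Some w)) = 2 * cmod (z - w) / sqrt ((1 + (cmod z)\<^sup>2) * (1 + (cmod w)\<^sup>2))" for z w
  proof (rule power2_eq_imp_eq)
    obtain a b where z: "z = Complex a b" by (cases z)
    obtain c d where w: "w = Complex c d" by (cases w)
    define u where "u = 1 / (1 + (cmod z)\<^sup>2)"
    define v where "v = 1 / (1 + (cmod w)\<^sup>2)"
    have u: "u * (1 + (a\<^sup>2 + b\<^sup>2)) = 1"
      using pos[of z] by (simp add: u_def z cmod_power2)
    have v: "v * (1 + (c\<^sup>2 + d\<^sup>2)) = 1"
      using pos[of w] by (simp add: v_def w cmod_power2)
    have "(dist (stereo (Some z)) (stereo (Some w)))\<^sup>2 =
       (cmod (of_real (2 * u) * z - of_real (2 * v) * w))\<^sup>2 + (2 * v - 2 * u)\<^sup>2"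
      by (simp add: stereo_def norm_Pair dist_norm u_def v_def)
    also have "\<dots> = (2 * u * a - 2 * v * c)\<^sup>2 + (2 * u * b - 2 * v * d)\<^sup>2 + (2 * v - 2 * u)\<^sup>2"
      by (simp add: cmod_power2 z w)
    also have "\<dots> = 4 * ((a-c)\<^sup>2 + (b-d)\<^sup>2) * (u * v)"
      using u v by algebra
    also have "\<dots> = (2 * cmod (z - w) / sqrt ((1 + (cmod z)\<^sup>2) * (1 + (cmod w)\<^sup>2)))\<^sup>2"
      using pos[of z] pos[of w] by (simp add: power_divide power_mult_distrib u_def v_def z w cmod_power2)
    finally show "(dist (stereo (Some z)) (stereo (Some w)))\<^sup>2 = (2 * cmod (z - w) / sqrt ((1 + (cmod z)\<^sup>2) * (1 + (cmod w)\<^sup>2)))\<^sup>2" .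
  qed auto
  show ?thesis
    using one two by (cases x; cases y) (auto simp: dist_commute)
qed

lemma rhoS_triangle: "rhoS x z \<le> rhoS x y + rhoS y z"
  unfolding rhoS_eq_dist by (rule dist_triangle)

lemma rhoS_commute: "rhoS x y = rhoS y x"
  unfolding rhoS_eq_dist by (rule dist_commute)

section \<open>Inversion as an isometry of the sphere\<close>

definition sinv :: "complex option \<Rightarrow> complex option" where
  "sinv x = (case x of None \<Rightarrow> Some 0 | Some w \<Rightarrow> if w = 0 then None else Some (inverse w))"

text \<open>The default 0 at infinity, together with \<open>inverse 0 = 0\<close>, makes inversion
  commute with \<open>cval\<close> without exception. Zeros and poles of f are then exactly the
  points with \<open>cval (f z) = 0\<close>.\<close>

definition cval :: "complex option \<Rightarrow> complex" where
  "cval x = (case x of None \<Rightarrow> 0 | Some w \<Rightarrow> w)"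

lemma sinv_sinv [simp]: "sinv (sinv x) = x"
  by (auto simp: sinv_def split: option.splits)

lemma cval_Some [simp]: "cval (Some z) = z"
  by (simp add: cval_def)

lemma cval_sinv: "cval (sinv x) = inverse (cval x)"
  by (auto simp: sinv_def cval_def split: option.splits)

lemma rhoS_sinv [simp]: "rhoS (sinv x) (sinv y) = rhoS x y"
proof -
  have pos: "1 + (cmod z)\<^sup>2 > 0" for z
    by (simp add: add_pos_nonneg)
  have inv: "sqrt (1 + (cmod (inverse z))\<^sup>2) = sqrt (1 + (cmod z)\<^sup>2) / cmod z" if "z \<noteq> 0" for z
  proof -
    have "1 + (cmod (inverse z))\<^sup>2 = (1 + (cmod z)\<^sup>2) / (cmod z)\<^sup>2"
      using that by (simp add: norm_inverse power_inverse add_divide_distrib inverse_eq_divide power_divide norm_divide)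
    then show ?thesis by (simp add: real_sqrt_divide)
  qed
  have diff: "cmod (inverse z - inverse w) = cmod (z - w) / (cmod z * cmod w)" if "z \<noteq> 0" "w \<noteq> 0" for z w
  proof -
    have "inverse z - inverse w = (w - z) / (z * w)" using that by (simp add: field_simps)
    then show ?thesis by (simp add: norm_divide norm_mult norm_minus_commute)
  qed
  have S: "sqrt (1 + (cmod z)\<^sup>2) > 0" for z using pos by simp
  show ?thesis
  proof (cases x; cases y)
    fix a b assume xy: "x = Some a" "y = Some b"
    consider "a = 0" "b = 0" | "a = 0" "b \<noteq> 0" | "a \<noteq> 0" "b = 0" | "a \<noteq> 0" "b \<noteq> 0" by blast
    then show ?thesis
    proof cases
      case 4
      define p q where "p = sqrt (1 + (cmod a)\<^sup>2)" and "q = sqrt (1 + (cmod b)\<^sup>2)"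
      have pq: "p > 0" "q > 0" using S by (auto simp: p_def q_def)
      have "rhoS (sinv x) (sinv y) = 2 * (cmod (a - b) / (cmod a * cmod b)) / (p / cmod a * (q / cmod b))"
        using 4 by (simp only: xy sinv_def option.case if_False rhoS.simps real_sqrt_mult inv[OF 4(1)] inv[OF 4(2)] diff[OF 4] p_def q_def)
      also have "\<dots> = 2 * cmod (a - b) / (p * q)" using 4 pq by simp
      finally show ?thesis by (simp add: xy real_sqrt_mult p_def q_def)
    qed (use S in \<open>simp_all add: xy sinv_def inv\<close>)
  next
    fix a assume "x = Some a" "y = None"
    then show ?thesis using S[of a] by (cases "a = 0") (simp_all add: sinv_def inv, simp add: norm_inverse)
  next
    fix b assume "x = None" "y = Some b"
    then show ?thesis using S[of b] by (cases "b = 0") (simp_all add: sinv_def inv, simp add: norm_inverse)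
  qed (simp add: sinv_def)
qed

lemma rhoS_Some_le: "rhoS (Some a) (Some b) \<le> 2 * cmod (a - b)"
proof -
  have "1 \<le> sqrt ((1 + (cmod a)\<^sup>2) * (1 + (cmod b)\<^sup>2))"
    using mult_mono[of 1 "1 + (cmod a)\<^sup>2" 1 "1 + (cmod b)\<^sup>2"] by simp
  then show ?thesis
    using frac_le[of "2 * cmod (a-b)" "2 * cmod (a-b)" 1] by simp
qed

lemma rhoS_near_bounded:
  assumes v: "cmod v \<le> 1" and rho: "rhoS (Some v) y < 1/2"
  shows "\<exists>u. y = Some u \<and> cmod u \<le> 2"
proof -
  have v2: "(cmod v)\<^sup>2 \<le> 1" using v by (simp add: power_le_one)
  show ?thesis
  proof (cases y)
    case None
    have "sqrt (1 + (cmod v)\<^sup>2) \<le> sqrt 4" using v2 by (intro real_sqrt_le_mono) simp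
    moreover have "sqrt (1 + (cmod v)\<^sup>2) > 0" by (simp add: add_pos_nonneg)
    ultimately show ?thesis using rho None by (simp add: field_simps)
  next
    case (Some u)
    show ?thesis
    proof (rule ccontr)
      assume "\<not> ?thesis"
      then have u: "cmod u > 2" using Some by simp
      have s: "sqrt ((1 + (cmod v)\<^sup>2) * (1 + (cmod u)\<^sup>2)) > 0"
        by (simp add: add_pos_nonneg)
      have "2 * (cmod u - 1) \<le> 2 * cmod (v - u)"
        using norm_triangle_ineq2[of u v] v by (simp add: norm_minus_commute)
      also have "\<dots> < 1/2 * sqrt ((1 + (cmod v)\<^sup>2) * (1 + (cmod u)\<^sup>2))"
        using rho s Some by (simp add: field_simps)
      also have "\<dots> \<le> 1/2 * sqrt (2 * (1 + (cmod u)\<^sup>2))"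
        using v2 by (intro mult_left_mono real_sqrt_le_mono mult_right_mono) auto
      finally have "4 * (cmod u - 1) < sqrt (2 * (1 + (cmod u)\<^sup>2))" by simp
      then have "(4 * (cmod u - 1))\<^sup>2 < 2 * (1 + (cmod u)\<^sup>2)"
        using u power_strict_mono[of "4 * (cmod u - 1)" "sqrt (2 * (1 + (cmod u)\<^sup>2))" 2] by simp
      \<comment> \<open>With x = |u| the previous inequality reads 14 x^2 - 32 x + 14 < 0, while
        this product equals 14 x^2 - 32 x + 8.\<close>
      moreover have "(cmod u - 2) * (14 * cmod u - 4) > 0" using u by (intro mult_pos_pos) auto
      ultimately show False by (simp add: power2_eq_square algebra_simps)
    qed
  qed
qed

section \<open>Sphere-valued meromorphic functions and equicontinuity\<close>

lemma isCont_holomorphic_ball: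
  assumes "g holomorphic_on ball z0 r" "r > 0"
  shows "isCont g z0"
proof -
  have "g field_differentiable at z0"
    by (rule holomorphic_on_imp_differentiable_at[OF assms(1)]) (use assms in auto)
  then show ?thesis by (rule field_differentiable_imp_continuous_at)
qed

lemma local_rep_sinv:
  assumes "local_rep f z0 m"
  shows "local_rep (\<lambda>z. sinv (f z)) z0 (-m)"
proof -
  obtain r g where r: "r > 0" "g holomorphic_on ball z0 r" "g z0 \<noteq> 0"
    and f: "\<And>z. z \<in> ball z0 r \<Longrightarrow> f z = (if z = z0 \<and> m < 0 then None else Some ((z - z0) powi m * g z))"
    using assms unfolding local_rep_def by blast
  have "continuous (at z0) g"
    using r by (intro isCont_holomorphic_ball) auto
  then obtain d where d: "d > 0" "\<And>z. dist z0 z < d \<Longrightarrow> g z \<noteq> 0"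
    using continuous_at_avoid[of z0 g 0] r(3) by blast
  show ?thesis unfolding local_rep_def
  proof (intro exI conjI ballI)
    show "min r d > 0" using r d by simp
    show "(\<lambda>z. inverse (g z)) holomorphic_on ball z0 (min r d)"
      using d by (intro holomorphic_intros holomorphic_on_subset[OF r(2)]) auto
    show "inverse (g z0) \<noteq> 0" using r by simp
    show "sinv (f z) = (if z = z0 \<and> - m < 0 then None else Some ((z - z0) powi - m * inverse (g z)))"
      if "z \<in> ball z0 (min r d)" for z
    proof -
      have "g z \<noteq> 0" using d that by simp
      then show ?thesis using that f[of z]
        by (cases "z = z0"; cases "m = 0") (auto simp: sinv_def power_int_minus power_int_0_left)
    qed
  qed
qed

lemma meromorphic_C_sinv: "meromorphic_C f \<Longrightarrow> meromorphic_C (\<lambda>z. sinv (f z))"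
  unfolding meromorphic_C_def using local_rep_sinv by blast

text \<open>Inversion is an isometry that maps constants to constants. Estimates therefore need
  proof only where |f| \<le> 1; the remaining points are covered by 1/f.\<close>

lemma class_N1_sinv:
  assumes "class_N1 f"
  shows "class_N1 (\<lambda>z. sinv (f z))"
proof -
  have "\<not> translates_converge (\<lambda>z. sinv (f z)) h (\<lambda>_. w)" for h w
  proof
    assume "translates_converge (\<lambda>z. sinv (f z)) h (\<lambda>_. w)"
    moreover have "rhoS (sinv x) w = rhoS x (sinv w)" for x
      using rhoS_sinv[of x "sinv w"] by simp
    ultimately have "translates_converge f h (\<lambda>_. sinv w)"
      by (simp add: translates_converge_def)
    then show False using assms unfolding class_N1_def by blast
  qed
  moreover have "normal_fn (\<lambda>z. sinv (f z))"
    using assms by (simp add: class_N1_def normal_fn_def)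
  ultimately show ?thesis
    using assms meromorphic_C_sinv by (auto simp: class_N1_def)
qed

lemma meromorphic_C_finite_at:
  assumes "meromorphic_C f" "f z0 \<noteq> None"
  shows "\<exists>r>0. \<exists>g. g holomorphic_on ball z0 r \<and> (\<forall>z\<in>ball z0 r. f z = Some (g z))"
proof -
  obtain m where "local_rep f z0 m" using assms(1) by (auto simp: meromorphic_C_def)
  then obtain r g where r: "r > 0" "g holomorphic_on ball z0 r"
    and f: "\<And>z. z \<in> ball z0 r \<Longrightarrow> f z = (if z = z0 \<and> m < 0 then None else Some ((z - z0) powi m * g z))"
    unfolding local_rep_def by blast
  have m: "m \<ge> 0" using f[of z0] r assms(2) by (cases "m < 0") auto
  show ?thesis
  proof (intro exI conjI ballI)
    show "r > 0" by fact
    show "(\<lambda>z. (z - z0) ^ nat m * g z) holomorphic_on ball z0 r"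
      by (intro holomorphic_intros r)
    show "f z = Some ((z - z0) ^ nat m * g z)" if "z \<in> ball z0 r" for z
      using f[OF that] m by (simp add: power_int_def)
  qed
qed

lemma meromorphic_C_holomorphic_on:
  assumes "meromorphic_C f" "open U" "\<And>z. z \<in> U \<Longrightarrow> f z \<noteq> None"
  shows "(\<lambda>z. cval (f z)) holomorphic_on U"
proof -
  have "(\<lambda>z. cval (f z)) field_differentiable (at z0)" if z0: "z0 \<in> U" for z0
  proof -
    obtain r g where r: "r > 0" "g holomorphic_on ball z0 r" "\<And>z. z \<in> ball z0 r \<Longrightarrow> f z = Some (g z)"
      using meromorphic_C_finite_at[OF assms(1) assms(3)[OF z0]] by blast
    have "(\<lambda>z. cval (f z)) holomorphic_on ball z0 r"
      using r(2) by (rule holomorphic_transform) (simp add: r(3))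
    then show ?thesis using r(1) by (simp add: holomorphic_on_imp_differentiable_at)
  qed
  then show ?thesis
    by (simp add: field_differentiable_at_within holomorphic_on_def)
qed

lemma meromorphic_C_continuous:
  assumes "meromorphic_C f" "e > 0"
  shows "\<exists>d>0. \<forall>z. dist z0 z < d \<longrightarrow> rhoS (f z) (f z0) < e"
proof -
  have main: "\<exists>d>0. \<forall>z. dist z0 z < d \<longrightarrow> rhoS (f z) (f z0) < e"
    if f: "meromorphic_C f" "f z0 \<noteq> None" for f
  proof -
    obtain r g where r: "r > 0" "g holomorphic_on ball z0 r" "\<And>z. z \<in> ball z0 r \<Longrightarrow> f z = Some (g z)"
      using meromorphic_C_finite_at[OF f] by blast
    have "continuous (at z0) g"
      using r by (intro isCont_holomorphic_ball) auto
    then obtain d where d: "d > 0" "\<And>z. dist z z0 < d \<Longrightarrow> dist (g z) (g z0) < e/2"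
      unfolding continuous_at_eps_delta using assms(2) half_gt_zero by blast
    show ?thesis
    proof (intro exI[of _ "min r d"] conjI allI impI)
      show "0 < min r d" using r d by simp
      fix z assume z: "dist z0 z < min r d"
      then have "rhoS (f z) (f z0) \<le> 2 * cmod (g z - g z0)"
        using r rhoS_Some_le by simp
      also have "\<dots> < e" using d(2)[of z] z by (simp add: dist_norm norm_minus_commute)
      finally show "rhoS (f z) (f z0) < e" .
    qed
  qed
  show ?thesis
  proof (cases "f z0")
    case None
    then have "sinv (f z0) \<noteq> None" by (simp add: sinv_def)
    from main[OF meromorphic_C_sinv[OF assms(1)] this] show ?thesis by simp
  next
    case Some
    then show ?thesis using main[OF assms(1)] by simp
  qed
qed

text \<open>If the claim fails at pairs z_n, w_n, the translates by w_n have a subsequence that is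
  uniformly Cauchy on the unit disc. Its late members lie within e/3 of a single translate, and the
  continuity of that one at the origin closes a three-term estimate.\<close>

lemma normal_fn_uniformly_continuous:
  assumes f: "meromorphic_C f" "normal_fn f" and e: "e > 0"
  shows "\<exists>\<delta>>0. \<forall>z w. dist z w < \<delta> \<longrightarrow> rhoS (f z) (f w) < e"
proof (rule ccontr)
  assume "\<not> ?thesis"
  then have neg: "\<exists>z w. dist z w < \<delta> \<and> \<not> rhoS (f z) (f w) < e" if "\<delta> > 0" for \<delta>
    using that by blast
  have "\<exists>p. dist (fst p) (snd p) < 1 / real (Suc n) \<and> rhoS (f (fst p)) (f (snd p)) \<ge> e" for n
  proof -
    have "1 / real (Suc n) > 0" by simp
    from neg[OF this] obtain z w where "dist z w < 1 / real (Suc n)" "\<not> rhoS (f z) (f w) < e" by blast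
    then show ?thesis by (intro exI[of _ "(z, w)"]) simp
  qed
  then have "\<forall>n. \<exists>p. dist (fst p) (snd p) < 1 / real (Suc n) \<and> rhoS (f (fst p)) (f (snd p)) \<ge> e"
    by blast
  then obtain p where p: "\<forall>n. dist (fst (p n)) (snd (p n)) < 1 / real (Suc n) \<and> rhoS (f (fst (p n))) (f (snd (p n))) \<ge> e"
    by (rule choice[THEN exE])
  define z where "z n = fst (p n)" for n
  define w where "w n = snd (p n)" for n
  have zw: "dist (z n) (w n) < 1 / real (Suc n)" "rhoS (f (z n)) (f (w n)) \<ge> e" for n
    using p by (simp_all add: z_def w_def)
  obtain \<sigma> :: "nat \<Rightarrow> nat" where \<sigma>: "strict_mono \<sigma>"
    and cauchy': "\<forall>K. compact K \<longrightarrow> (\<forall>\<epsilon>>0. \<exists>N. \<forall>m\<ge>N. \<forall>n\<ge>N. \<forall>x\<in>K.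
        rhoS (f (x + w (\<sigma> m))) (f (x + w (\<sigma> n))) < \<epsilon>)"
    using spec[OF f(2)[unfolded normal_fn_def], of w] by (elim exE conjE)
  have cauchy: "\<exists>N. \<forall>m\<ge>N. \<forall>n\<ge>N. \<forall>x\<in>K.
        rhoS (f (x + w (\<sigma> m))) (f (x + w (\<sigma> n))) < \<epsilon>" if "compact K" "\<epsilon> > 0" for K \<epsilon>
    using cauchy' that by simp
  have e3: "e / 3 > 0" using e by simp
  from cauchy[OF compact_cball this, of 0 1] obtain N
    where N': "\<forall>m\<ge>N. \<forall>n\<ge>N. \<forall>x\<in>cball 0 1. rhoS (f (x + w (\<sigma> m))) (f (x + w (\<sigma> n))) < e/3" by (rule exE)
  have N: "rhoS (f (x + w (\<sigma> m))) (f (x + w (\<sigma> n))) < e/3" if "m \<ge> N" "n \<ge> N" "x \<in> cball 0 1" for m n x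
    using N' that by simp
  from meromorphic_C_continuous[OF f(1) e3, of "w (\<sigma> N)"]
  obtain d where d: "d > 0" "\<forall>x. dist (w (\<sigma> N)) x < d \<longrightarrow> rhoS (f x) (f (w (\<sigma> N))) < e/3"
    by (elim exE conjE)
  obtain k where k: "1 / real (Suc k) < d" using nat_approx_posE[OF d(1)] by blast
  \<comment> \<open>Beyond N the translates are e/3-close; beyond k the offset x is shorter than
    1/(k+1) and so lies inside the disc of continuity.\<close>
  define n where "n = max k N"
  define x where "x = z (\<sigma> n) - w (\<sigma> n)"
  have "n \<le> \<sigma> n" using \<sigma> by (rule strict_mono_imp_increasing)
  then have "1 / real (Suc (\<sigma> n)) \<le> 1 / real (Suc k)"
    unfolding n_def by (intro divide_left_mono) auto
  then have xd: "cmod x < d" using zw(1)[of "\<sigma> n"] k by (simp add: x_def dist_norm)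
  have "1 / real (Suc (\<sigma> n)) \<le> 1" by simp
  moreover have "cmod x < 1 / real (Suc (\<sigma> n))" using zw(1)[of "\<sigma> n"] by (simp only: x_def dist_norm)
  ultimately have x1: "cmod x \<le> 1" by linarith
  have "e \<le> rhoS (f (x + w (\<sigma> n))) (f (w (\<sigma> n)))" using zw(2)[of "\<sigma> n"] by (simp add: x_def)
  also have "\<dots> \<le> rhoS (f (x + w (\<sigma> n))) (f (x + w (\<sigma> N))) + (rhoS (f (x + w (\<sigma> N))) (f (w (\<sigma> N))) + rhoS (f (w (\<sigma> N))) (f (w (\<sigma> n))))"
    using rhoS_triangle[of "f (x + w (\<sigma> n))" "f (w (\<sigma> n))" "f (x + w (\<sigma> N))"]
      rhoS_triangle[of "f (x + w (\<sigma> N))" "f (w (\<sigma> n))" "f (w (\<sigma> N))"] by linarith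
  also have "\<dots> < e/3 + (e/3 + e/3)"
  proof (intro add_strict_mono)
    show "rhoS (f (x + w (\<sigma> n))) (f (x + w (\<sigma> N))) < e/3"
      using x1 by (intro N) (simp_all add: n_def)
    show "rhoS (f (x + w (\<sigma> N))) (f (w (\<sigma> N))) < e/3"
      using d(2)[rule_format, of "x + w (\<sigma> N)"] xd by (simp add: dist_norm)
    show "rhoS (f (w (\<sigma> N))) (f (w (\<sigma> n))) < e/3"
      using N[of N n 0] by (simp add: n_def)
  qed
  finally show False by simp
qed

subsection \<open>Bounded holomorphic functions on a disc\<close>

text \<open>Harnack's inequality for the positive function A - Re h, obtained from the Schwarz
  lemma: the Cayley transform \<phi> of the rescaled function K fixes 0 and maps the unit disc into
  itself. On the half disc |\<phi>| \<le> 1/2, which bounds |K| by (1 + 1/2) / (1 - 1/2) = 3 times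
  its central value.\<close>

lemma Harnack_lower_bound:
  assumes h: "h holomorphic_on ball z0 r" and r: "r > 0"
    and A: "\<And>z. z \<in> ball z0 r \<Longrightarrow> Re (h z) < A" and z: "z \<in> ball z0 (r / 2)"
  shows "A - Re (h z) \<le> 3 * (A - Re (h z0))"
proof -
  define u where "u = A - Re (h z0)"
  \<comment> \<open>The imaginary constant makes K 0 equal to the real number u, so that \<phi> 0 =
    0.\<close>
  define K where "K = (\<lambda>w. of_real A - h (z0 + of_real r * w) + \<i> * of_real (Im (h z0)))"
  define \<phi> where "\<phi> = (\<lambda>w. (K w - of_real u) / (K w + of_real u))"
  have mem: "z0 + of_real r * w \<in> ball z0 r" if "cmod w < 1" for w
    using that r by (simp add: dist_norm norm_mult)
  have u: "u > 0" using A[of z0] r by (simp add: u_def)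
  have K: "Re (K w) > 0" if "cmod w < 1" for w
    using A[OF mem[OF that]] by (simp add: K_def)
  have ne: "K w + of_real u \<noteq> 0" if "cmod w < 1" for w
  proof
    assume "K w + of_real u = 0"
    then have "Re (K w) + u = 0" by (metis Re_complex_of_real plus_complex.sel(1) zero_complex.sel(1))
    then show False using K[OF that] u by simp
  qed
  have K0: "K 0 = of_real u"
    by (simp add: K_def u_def complex_eq_iff)
  have "(h \<circ> (\<lambda>w. z0 + of_real r * w)) holomorphic_on ball 0 1"
    by (rule holomorphic_on_compose_gen[OF _ h]) (use mem in \<open>auto intro!: holomorphic_intros\<close>)
  then have holK: "K holomorphic_on ball 0 1"
    unfolding K_def by (intro holomorphic_intros) (simp add: o_def)
  have hol: "\<phi> holomorphic_on ball 0 1"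
    unfolding \<phi>_def by (intro holomorphic_intros holK) (use ne in auto)
  have lt1: "cmod (\<phi> w) < 1" if w: "cmod w < 1" for w
  proof -
    have "(Re (K w) - u)\<^sup>2 < (Re (K w) + u)\<^sup>2"
      using K[OF w] u by (simp add: power2_eq_square algebra_simps)
    then have "(cmod (K w - of_real u))\<^sup>2 < (cmod (K w + of_real u))\<^sup>2"
      by (simp add: cmod_power2)
    then have "cmod (K w - of_real u) < cmod (K w + of_real u)"
      by (rule power2_less_imp_less) simp
    then show ?thesis using ne[OF w] by (simp add: \<phi>_def norm_divide)
  qed
  define w where "w = (z - z0) / of_real r"
  have zw: "z = z0 + of_real r * w" using r by (simp add: w_def)
  have w: "cmod w < 1/2" using z r by (simp add: w_def norm_divide dist_norm norm_minus_commute)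
  have "cmod (\<phi> w) \<le> cmod w"
    by (rule Schwarz_Lemma(1)[OF hol]) (use lt1 w in \<open>auto simp: \<phi>_def K0\<close>)
  then have "cmod (\<phi> w) \<le> 1/2" using w by simp
  then have "cmod (K w - of_real u) \<le> 1/2 * cmod (K w + of_real u)"
    using ne[of w] w by (simp add: \<phi>_def norm_divide divide_simps)
  moreover have "cmod (K w) - u \<le> cmod (K w - of_real u)"
    using norm_triangle_ineq2[of "K w" "of_real u"] u by simp
  moreover have "cmod (K w + of_real u) \<le> cmod (K w) + u"
    using norm_triangle_ineq[of "K w" "of_real u"] u by simp
  ultimately have "cmod (K w) \<le> 3 * u" by linarith
  then have "Re (K w) \<le> 3 * u" using complex_Re_le_cmod[of "K w"] by linarith
  then show ?thesis by (simp add: K_def u_def zw[symmetric])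
qed

lemma norm_prod_list_diff:
  "cmod (prod_list (map (\<lambda>a. z - a) as)) = prod_list (map (\<lambda>a. cmod (z - a)) as)"
  by (induction as) (auto simp: norm_mult)

lemma prod_list_norm_ge:
  fixes d :: real
  assumes "\<And>a. a \<in> set as \<Longrightarrow> d \<le> cmod (z - a)" "d \<ge> 0"
  shows "d ^ length as \<le> prod_list (map (\<lambda>a. cmod (z - a)) as)"
  using assms by (induction as) (auto intro!: mult_mono prod_list_nonneg)

lemma prod_list_norm_le:
  fixes d :: real
  assumes "\<And>a. a \<in> set as \<Longrightarrow> cmod (z - a) \<le> d"
  shows "prod_list (map (\<lambda>a. cmod (z - a)) as) \<le> d ^ length as"
  using assms
proof (induction as)
  case (Cons a as)
  have "0 \<le> d" using Cons.prems[of a] norm_ge_zero[of "z - a"] by (simp del: norm_ge_zero)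
  then show ?case using Cons by (auto intro!: mult_mono prod_list_nonneg)
qed simp

lemma ln_prod_list:
  fixes F :: "'a \<Rightarrow> real"
  assumes "\<And>a. a \<in> set as \<Longrightarrow> F a > 0"
  shows "ln (prod_list (map F as)) = sum_list (map (\<lambda>a. ln (F a)) as)"
    and "prod_list (map F as) > 0"
proof -
  have "ln (prod_list (map F as)) = sum_list (map (\<lambda>a. ln (F a)) as) \<and> prod_list (map F as) > 0"
    using assms
  proof (induction as)
    case (Cons a as)
    have "F a > 0" using Cons.prems by simp
    moreover have "ln (prod_list (map F as)) = sum_list (map (\<lambda>a. ln (F a)) as) \<and> prod_list (map F as) > 0"
      using Cons by auto
    ultimately show ?case by (simp add: ln_mult)
  qed simp
  then show "ln (prod_list (map F as)) = sum_list (map (\<lambda>a. ln (F a)) as)" "prod_list (map F as) > 0"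
    by auto
qed

text \<open>The factorization may be partial: g can still vanish. Confining the split-off zeros to
  the quarter disc makes each linear factor at least \<rho>/2 on the circle of radius 3\<rho>/4 but
  at most \<rho>/4 at the centre; the ratio 2 between these bounds limits the number of
  factors.\<close>

definition zero_splitting :: "(complex \<Rightarrow> complex) \<Rightarrow> complex \<Rightarrow> real \<Rightarrow> complex list \<Rightarrow> (complex \<Rightarrow> complex) \<Rightarrow> bool"
  where "zero_splitting F z0 \<rho> as g \<longleftrightarrow> g holomorphic_on ball z0 \<rho> \<and> set as \<subseteq> ball z0 (\<rho> / 4) \<and>
     (\<forall>z\<in>ball z0 \<rho>. F z = prod_list (map (\<lambda>a. z - a) as) * g z)"

text \<open>The maximum principle on the disc of radius 3\<rho>/4 bounds g by 2 / (\<rho>/2)^n,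
  where n is the number of factors. At the centre this gives \<eta> \<le> (\<rho>/4)^n * 2 /
  (\<rho>/2)^n = 2 / 2^n. Since \<rho> \<le> 1, the factors at the centre are at most 1, so the
  lower bound for F passes to g.\<close>

lemma zero_splitting_bounds:
  assumes sp: "zero_splitting F z0 \<rho> as g" and \<rho>: "0 < \<rho>" "\<rho> \<le> 1"
    and F: "\<And>z. z \<in> ball z0 \<rho> \<Longrightarrow> cmod (F z) \<le> 2" and \<eta>: "cmod (F z0) \<ge> \<eta>" "\<eta> > 0"
  shows "\<And>z. z \<in> ball z0 (\<rho> / 4) \<Longrightarrow> cmod (g z) \<le> 2 / (\<rho> / 2) ^ length as"
    and "\<eta> \<le> cmod (g z0)" and "\<eta> * 2 ^ length as \<le> 2"
proof -
  let ?N = "length as"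
  let ?P = "\<lambda>z. prod_list (map (\<lambda>a. cmod (z - a)) as)"
  have g: "g holomorphic_on ball z0 \<rho>" and as: "set as \<subseteq> ball z0 (\<rho> / 4)"
    and eq: "\<And>z. z \<in> ball z0 \<rho> \<Longrightarrow> F z = prod_list (map (\<lambda>a. z - a) as) * g z"
    using sp by (auto simp: zero_splitting_def)
  have nF: "cmod (F z) = ?P z * cmod (g z)" if "z \<in> ball z0 \<rho>" for z
    by (simp add: eq[OF that] norm_mult norm_prod_list_diff)
  have bd: "cmod (g z) \<le> 2 / (\<rho> / 2) ^ ?N" if z: "z \<in> cball z0 (3 * \<rho> / 4)" for z
  proof (rule maximum_modulus_frontier[of g "cball z0 (3 * \<rho> / 4)"])
    have sub: "cball z0 (3 * \<rho> / 4) \<subseteq> ball z0 \<rho>" using \<rho> by auto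
    then show "g holomorphic_on interior (cball z0 (3 * \<rho> / 4))"
      using interior_subset by (intro holomorphic_on_subset[OF g]) blast
    show "continuous_on (closure (cball z0 (3 * \<rho> / 4))) g"
      using sub by (auto intro!: holomorphic_on_imp_continuous_on holomorphic_on_subset[OF g])
    fix w assume "w \<in> frontier (cball z0 (3 * \<rho> / 4))"
    then have w: "dist z0 w = 3 * \<rho> / 4" using \<rho> by (simp add: frontier_cball)
    then have wb: "w \<in> ball z0 \<rho>" using \<rho> by simp
    have "\<rho> / 2 \<le> cmod (w - a)" if "a \<in> set as" for a
    proof -
      have "dist z0 a < \<rho> / 4" using as that by auto
      then show ?thesis using dist_triangle[of z0 w a] w by (simp add: dist_norm norm_minus_commute)
    qed
    then have P: "(\<rho> / 2) ^ ?N \<le> ?P w" using \<rho> by (intro prod_list_norm_ge) auto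
    have "(\<rho> / 2) ^ ?N * cmod (g w) \<le> ?P w * cmod (g w)"
      by (intro mult_right_mono P) simp
    also have "\<dots> \<le> 2" using F[OF wb] nF[OF wb] by simp
    finally show "cmod (g w) \<le> 2 / (\<rho> / 2) ^ ?N"
      using \<rho> by (simp add: pos_le_divide_eq mult.commute)
  qed (use z in auto)
  then show "cmod (g z) \<le> 2 / (\<rho> / 2) ^ ?N" if "z \<in> ball z0 (\<rho> / 4)" for z
    using that \<rho> by (auto simp: dist_norm)
  have z0: "z0 \<in> ball z0 \<rho>" using \<rho> by simp
  have d4: "cmod (z0 - a) \<le> \<rho> / 4" if "a \<in> set as" for a
    using as that by (auto simp: dist_norm)
  have P0: "?P z0 \<le> (\<rho> / 4) ^ ?N" by (intro prod_list_norm_le d4)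
  have "(\<rho> / 4) ^ ?N \<le> 1" using \<rho> by (intro power_le_one) auto
  with P0 have "?P z0 \<le> 1" by linarith
  then have "?P z0 * cmod (g z0) \<le> 1 * cmod (g z0)"
    by (intro mult_right_mono) auto
  then show "\<eta> \<le> cmod (g z0)" using nF[OF z0] \<eta> by simp
  have "\<eta> \<le> ?P z0 * cmod (g z0)" using nF[OF z0] \<eta> by simp
  also have "\<dots> \<le> (\<rho> / 4) ^ ?N * (2 / (\<rho> / 2) ^ ?N)"
    using \<rho> by (intro mult_mono P0 bd) auto
  also have "(\<rho> / 4) ^ ?N = (\<rho> / 2) ^ ?N * (1 / 2) ^ ?N"
    by (simp flip: power_mult_distrib)
  also have "\<dots> * (2 / (\<rho> / 2) ^ ?N) = 2 / 2 ^ ?N"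
    using \<rho> by (simp add: power_one_over)
  finally show "\<eta> * 2 ^ ?N \<le> 2" by (simp add: field_simps)
qed

lemma zero_splitting_Cons:
  assumes sp: "zero_splitting F z0 \<rho> as g" and a: "a \<in> ball z0 (\<rho> / 4)" "g a = 0"
  shows "\<exists>k. zero_splitting F z0 \<rho> (a # as) k"
proof -
  let ?k = "\<lambda>z. if z = a then deriv g a else (g z - g a) / (z - a)"
  have g: "g holomorphic_on ball z0 \<rho>" using sp by (simp add: zero_splitting_def)
  have "0 < \<rho>" using a zero_le_dist[of z0 a] by (simp del: zero_le_dist)
  then have "a \<in> interior (ball z0 \<rho>)" using a by simp
  then have k: "?k holomorphic_on ball z0 \<rho>" by (rule pole_lemma[OF g])
  have gk: "g z = (z - a) * ?k z" for z using a by simp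
  have "prod_list (map (\<lambda>a. z - a) as) * g z = prod_list (map (\<lambda>a. z - a) (a # as)) * ?k z" for z
    by (subst gk) (simp only: list.map prod_list.Cons mult_ac)
  then have "zero_splitting F z0 \<rho> (a # as) ?k"
    using sp k a(1) unfolding zero_splitting_def by (simp only: list.set insert_subset) simp
  then show ?thesis by blast
qed

text \<open>A splitting with the most factors exists because their number is bounded. Its g has no
  zero in the quarter disc, since such a zero could be split off too; hence g has a holomorphic
  logarithm there, and Harnack's inequality bounds it from below on the disc of half that
  radius.\<close>

lemma bounded_holomorphic_ln_bound:
  assumes \<rho>: "0 < \<rho>" "\<rho> \<le> 1" and \<eta>: "\<eta> > 0"
  shows "\<exists>N B. \<forall>F z0. F holomorphic_on ball z0 \<rho> \<and> (\<forall>z\<in>ball z0 \<rho>. cmod (F z) \<le> 2) \<and> \<eta> \<le> cmod (F z0) \<longrightarrow>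
     (\<exists>as. length as \<le> N \<and> (\<forall>z\<in>ball z0 (\<rho> / 8). F z \<noteq> 0 \<longrightarrow>
        (\<forall>a\<in>set as. 0 < cmod (z - a) \<and> cmod (z - a) \<le> 1) \<and>
        \<bar>ln (cmod (F z))\<bar> \<le> B - sum_list (map (\<lambda>a. ln (cmod (z - a))) as)))"
proof -
  obtain N :: nat where N: "2 / \<eta> < 2 ^ N" using real_arch_pow[of 2 "2 / \<eta>"] by auto
  \<comment> \<open>The summand 1 makes the upper bound for Re h strict, as
    \<open>Harnack_lower_bound\<close> requires. In \<open>B\<close>, the term ln 2 bounds ln|F|
    from above, and the other one is Harnack's bound for - Re h with ln \<eta> at the
    centre.\<close>
  define A where "A = ln (2 / (\<rho> / 2) ^ N) + 1"
  define B where "B = max (ln 2) (3 * (A - ln \<eta>) - A)"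
  show ?thesis
  proof (intro exI[of _ N] exI[of _ B] allI impI, elim conjE)
    fix F z0 assume F: "F holomorphic_on ball z0 \<rho>" "\<forall>z\<in>ball z0 \<rho>. cmod (F z) \<le> 2" "\<eta> \<le> cmod (F z0)"
    let ?P = "\<lambda>p. zero_splitting F z0 \<rho> (fst p) (snd p)"
    have bounds: "\<And>z. z \<in> ball z0 (\<rho> / 4) \<Longrightarrow> cmod (g z) \<le> 2 / (\<rho> / 2) ^ length as"
      "\<eta> \<le> cmod (g z0)" "length as \<le> N" if "zero_splitting F z0 \<rho> as g" for as g
    proof -
      note b = zero_splitting_bounds[OF that \<rho> F(2)[rule_format] F(3) \<eta>]
      show "\<And>z. z \<in> ball z0 (\<rho> / 4) \<Longrightarrow> cmod (g z) \<le> 2 / (\<rho> / 2) ^ length as" "\<eta> \<le> cmod (g z0)"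
        using b by auto
      have "(2::real) ^ length as \<le> 2 / \<eta>" using b(3) \<eta> by (simp add: field_simps)
      with N have "(2::real) ^ length as < 2 ^ N" by linarith
      then show "length as \<le> N" by simp
    qed
    have "?P ([], F)" using F by (simp add: zero_splitting_def)
    moreover have "\<forall>p. ?P p \<longrightarrow> length (fst p) < Suc N" using bounds(3) by (auto simp: less_Suc_eq_le)
    ultimately have "\<exists>p. ?P p \<and> (\<forall>q. ?P q \<longrightarrow> length (fst q) \<le> length (fst p))"
      by (rule ex_has_greatest_nat)
    then obtain p where p: "?P p" "\<And>q. ?P q \<Longrightarrow> length (fst q) \<le> length (fst p)" by blast
    define as g where "as = fst p" and "g = snd p"
    have sp: "zero_splitting F z0 \<rho> as g" using p by (simp add: as_def g_def)
    note bd = bounds[OF sp]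
    have nz: "g z \<noteq> 0" if zb: "z \<in> ball z0 (\<rho> / 4)" for z
    proof
      assume "g z = 0"
      then obtain k where "zero_splitting F z0 \<rho> (z # as) k"
        using zero_splitting_Cons[OF sp zb] by blast
      then show False using p(2)[of "(z # as, k)"] by (simp add: as_def)
    qed
    have sub: "ball z0 (\<rho> / 4) \<subseteq> ball z0 \<rho>" using \<rho> by auto
    have g: "g holomorphic_on ball z0 (\<rho> / 4)"
      using sp holomorphic_on_subset[OF _ sub] by (simp add: zero_splitting_def)
    obtain h where h: "h holomorphic_on ball z0 (\<rho> / 4)" "\<And>z. z \<in> ball z0 (\<rho> / 4) \<Longrightarrow> g z = exp (h z)"
      using contractible_imp_holomorphic_log[OF g convex_imp_contractible[OF convex_ball] nz] by blast
    have Re: "Re (h z) = ln (cmod (g z))" if "z \<in> ball z0 (\<rho> / 4)" for z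
      by (simp add: h(2)[OF that])
    have upper: "Re (h z) < A" if z: "z \<in> ball z0 (\<rho> / 4)" for z
    proof -
      have "cmod (g z) \<le> 2 / (\<rho> / 2) ^ length as" by (rule bd(1)[OF z])
      also have "\<dots> \<le> 2 / (\<rho> / 2) ^ N"
        using \<rho> bd(3) by (intro divide_left_mono power_decreasing) auto
      finally have "ln (cmod (g z)) \<le> ln (2 / (\<rho> / 2) ^ N)"
        using nz[OF z] by (intro ln_mono) auto
      then show ?thesis by (simp add: Re[OF z] A_def)
    qed
    show "\<exists>as. length as \<le> N \<and> (\<forall>z\<in>ball z0 (\<rho> / 8). F z \<noteq> 0 \<longrightarrow>
        (\<forall>a\<in>set as. 0 < cmod (z - a) \<and> cmod (z - a) \<le> 1) \<and>
        \<bar>ln (cmod (F z))\<bar> \<le> B - sum_list (map (\<lambda>a. ln (cmod (z - a))) as))"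
    proof (intro exI[of _ as] conjI ballI impI)
      show "length as \<le> N" by (rule bd(3))
      fix z assume z: "z \<in> ball z0 (\<rho> / 8)" and Fz: "F z \<noteq> 0"
      have z4: "z \<in> ball z0 (\<rho> / 4)" and z1: "z \<in> ball z0 \<rho>" using z \<rho> by auto
      have eq: "F z = prod_list (map (\<lambda>a. z - a) as) * g z"
        using sp z1 by (simp add: zero_splitting_def)
      have a0: "0 < cmod (z - a)" if "a \<in> set as" for a
        using Fz that by (auto simp: eq prod_list_zero_iff)
      have a1: "cmod (z - a) \<le> 1" if "a \<in> set as" for a
      proof -
        have "dist z0 a < \<rho> / 4" using sp that by (auto simp: zero_splitting_def)
        moreover have "dist z0 z < \<rho> / 8" using z by simp
        ultimately show ?thesis using dist_triangle2[of z a z0] \<rho> by (simp add: dist_norm norm_minus_commute)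
      qed
      show "0 < cmod (z - a)" "cmod (z - a) \<le> 1" if "a \<in> set as" for a
        using a0 a1 that by auto
      let ?S = "sum_list (map (\<lambda>a. ln (cmod (z - a))) as)"
      have "cmod (F z) = prod_list (map (\<lambda>a. cmod (z - a)) as) * cmod (g z)"
        by (simp add: eq norm_mult norm_prod_list_diff)
      then have lnF: "ln (cmod (F z)) = ?S + Re (h z)"
        using ln_prod_list[of as "\<lambda>a. cmod (z - a)"] a0 nz[OF z4] by (simp add: ln_mult Re[OF z4])
      \<comment> \<open>All linear factors have modulus at most 1, so - ?S is nonnegative and may be
        added to the upper bound for ln|F|. One right-hand side then serves both signs.\<close>
      have "?S \<le> sum_list (map (\<lambda>a. 0) as)"
        by (intro sum_list_mono) (use a0 a1 in \<open>auto simp: ln_le_zero_iff\<close>)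
      then have S: "?S \<le> 0" by (simp add: sum_list_0)
      have "ln (cmod (F z)) \<le> ln 2" using F(2) z1 Fz by simp
      then have up: "ln (cmod (F z)) \<le> B - ?S" using S by (simp add: B_def)
      have "A - Re (h z) \<le> 3 * (A - Re (h z0))"
        using \<rho> z by (intro Harnack_lower_bound[OF h(1) _ upper]) auto
      moreover have "ln \<eta> \<le> Re (h z0)" using bd(2) \<eta> \<rho> by (subst Re) (auto intro!: ln_mono)
      ultimately have "- Re (h z) \<le> B" by (simp add: B_def)
      then show "\<bar>ln (cmod (F z))\<bar> \<le> B - ?S" using up by (simp add: lnF abs_le_iff)
    qed
  qed
qed

subsection \<open>Integrals over circles\<close>

text \<open>Angles up to 1 stay below pi/3, where cos is at least 1/2, and so sin u \<ge> u/2. The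
  imaginary part of cis (x - y) - 1 already gives the bound.\<close>

lemma norm_cis_diff_ge:
  assumes "\<bar>x - y\<bar> \<le> 1"
  shows "\<bar>x - y\<bar> / 2 \<le> cmod (cis x - cis y)"
proof -
  have sin: "u / 2 \<le> sin u" if u: "0 \<le> u" "u \<le> 1" for u :: real
  proof -
    have "sin 0 - 0 / 2 \<le> sin u - u / 2"
    proof (rule DERIV_nonneg_imp_nondecreasing[OF u(1)])
      fix v assume v: "0 \<le> v" "v \<le> u"
      have "v \<le> pi / 3" using v u pi_gt3 by simp
      then have "cos (pi / 3) \<le> cos v" using v by (intro cos_monotone_0_pi_le) auto
      then show "\<exists>D. ((\<lambda>u. sin u - u / 2) has_real_derivative D) (at v) \<and> 0 \<le> D"
        by (intro exI[of _ "cos v - 1/2"]) (auto intro!: derivative_eq_intros simp: cos_60)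
    qed
    then show ?thesis by simp
  qed
  have "cis x - cis y = cis y * (cis (x - y) - 1)"
    by (simp add: right_diff_distrib cis_mult)
  then have "cmod (cis x - cis y) = cmod (cis (x - y) - 1)" by (simp add: norm_mult)
  moreover have "\<bar>sin (x - y)\<bar> \<le> cmod (cis (x - y) - 1)"
    using abs_Im_le_cmod[of "cis (x - y) - 1"] by simp
  moreover have "\<bar>x - y\<bar> / 2 \<le> \<bar>sin (x - y)\<bar>"
  proof (cases "x \<ge> y")
    case True
    then show ?thesis using sin[of "x - y"] assms by auto
  next
    case False
    then show ?thesis using sin[of "y - x"] assms sin_minus[of "x - y"] by auto
  qed
  ultimately show ?thesis by linarith
qed

lemma norm_cis_diff_le: "cmod (cis x - cis y) \<le> \<bar>x - y\<bar>"
proof -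
  have "cis x - cis y = cis y * (cis (x - y) - 1)"
    by (simp add: right_diff_distrib cis_mult)
  then have "cmod (cis x - cis y) = 2 * \<bar>sin ((x - y) / 2)\<bar>"
    using dist_exp_i_1[of "x - y"] by (simp add: norm_mult cis_conv_exp)
  then show ?thesis using abs_sin_x_le_abs_x[of "(x - y) / 2"] by simp
qed

text \<open>This trades the logarithmic singularity for an inverse square root, which has an
  explicit primitive and turns a factor t inside into a factor 1 / sqrt t outside.\<close>

lemma minus_ln_le_sqrt:
  assumes "y > (0::real)"
  shows "- ln y \<le> 2 / sqrt y"
proof -
  have "ln (1 / sqrt y) \<le> 1 / sqrt y - 1" using assms by (intro ln_le_minus_one) simp
  moreover have "ln (1 / sqrt y) = - ln y / 2" using assms by (simp add: ln_div ln_sqrt)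
  ultimately show ?thesis by simp
qed

text \<open>Since \<open>sqrt\<close> is extended to negative numbers as an odd function, 2 sqrt
  (\<theta> - s) is a continuous primitive on both sides of the singularity s, wherever s
  lies.\<close>

lemma integral_inverse_sqrt:
  assumes "p \<le> q"
  shows "((\<lambda>\<theta>. 1 / sqrt \<bar>\<theta> - s\<bar>) has_integral (2 * sqrt (q - s) - 2 * sqrt (p - s))) {p..q}"
proof (rule fundamental_theorem_of_calculus_strong[of "{s}"])
  show "continuous_on {p..q} (\<lambda>\<theta>. 2 * sqrt (\<theta> - s))"
    by (intro continuous_intros)
  fix x assume "x \<in> {p..q} - {s}"
  then have x: "x - s \<noteq> 0" by simp
  have "(sqrt has_real_derivative (1 / sqrt \<bar>x - s\<bar>) / 2) (at (x - s))"
    by (rule DERIV_real_sqrt_generic[OF x]) (use real_sqrt_minus[of "s - x"] in \<open>auto simp: field_simps\<close>)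
  moreover have "((\<lambda>\<theta>. \<theta> - s) has_real_derivative 1) (at x)"
    by (auto intro!: derivative_eq_intros)
  ultimately have "((\<lambda>\<theta>. sqrt (\<theta> - s)) has_real_derivative (1 / sqrt \<bar>x - s\<bar>) / 2 * 1) (at x)"
    by (rule DERIV_chain2)
  from DERIV_cmult[OF this, of 2]
  show "((\<lambda>\<theta>. 2 * sqrt (\<theta> - s)) has_vector_derivative 1 / sqrt \<bar>x - s\<bar>) (at x)"
    by (simp add: has_real_derivative_iff_has_vector_derivative)
qed (use assms in auto)

text \<open>The arc lies at distance at least \<open>t\<bar>\<theta> - s\<bar>/4\<close> from \<open>b\<close>, where \<open>s\<close> is the angle of its
  point closest to \<open>b\<close>.\<close>
lemma arc_integral_bound:
  assumes \<alpha>: "0 < \<alpha>" "\<alpha> \<le> 1" and \<kappa>: "0 < \<kappa>" "\<kappa> \<le> t * \<alpha>"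
    and nz: "\<And>\<theta>. \<theta> \<in> {p..p+\<alpha>} \<Longrightarrow> of_real t * cis \<theta> \<noteq> b"
  shows "\<exists>I. ((\<lambda>\<theta>. - ln (cmod (of_real t * cis \<theta> - b))) has_integral I) {p..p+\<alpha>} \<and> I \<le> 16 / sqrt \<kappa> * \<alpha>"
proof -
  let ?d = "\<lambda>\<theta>. cmod (of_real t * cis \<theta> - b)"
  have t: "t > 0" using \<alpha> \<kappa> by (metis less_le_trans zero_less_mult_pos2)
  have cont: "continuous_on {p..p+\<alpha>} ?d" by (intro continuous_intros)
  obtain s where s: "s \<in> {p..p+\<alpha>}" "\<And>\<theta>. \<theta> \<in> {p..p+\<alpha>} \<Longrightarrow> ?d s \<le> ?d \<theta>"
    using continuous_attains_inf[OF compact_Icc _ cont] \<alpha> by force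
  have "continuous_on {p..p+\<alpha>} (\<lambda>\<theta>. - ln (?d \<theta>))"
    by (intro continuous_intros) (use nz in auto)
  then have int: "((\<lambda>\<theta>. - ln (?d \<theta>)) has_integral integral {p..p+\<alpha>} (\<lambda>\<theta>. - ln (?d \<theta>))) {p..p+\<alpha>}"
    using integrable_continuous_interval by blast
  let ?J = "8 / sqrt t * (sqrt (p + \<alpha> - s) - sqrt (p - s))"
  have "((\<lambda>\<theta>. 4 / sqrt t * (1 / sqrt \<bar>\<theta> - s\<bar>)) has_integral
      4 / sqrt t * (2 * sqrt (p + \<alpha> - s) - 2 * sqrt (p - s))) {p..p+\<alpha>}"
    using \<alpha> by (intro has_integral_mult_right integral_inverse_sqrt) simp
  \<comment> \<open>At \<theta> = s the majorant takes the default value 1 / 0 = 0, which need not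
    dominate; changing one point repairs this without altering the integral.\<close>
  then have maj: "((\<lambda>\<theta>. if \<theta> = s then - ln (?d s) else 4 / sqrt t * (1 / sqrt \<bar>\<theta> - s\<bar>)) has_integral
      4 / sqrt t * (2 * sqrt (p + \<alpha> - s) - 2 * sqrt (p - s))) {p..p+\<alpha>}"
    by (rule has_integral_spike_finite[of "{s}", rotated -1]) auto
  have "integral {p..p+\<alpha>} (\<lambda>\<theta>. - ln (?d \<theta>)) \<le> 4 / sqrt t * (2 * sqrt (p + \<alpha> - s) - 2 * sqrt (p - s))"
  proof (rule has_integral_le[OF int maj])
    fix \<theta> assume \<theta>: "\<theta> \<in> {p..p+\<alpha>}"
    show "- ln (?d \<theta>) \<le> (if \<theta> = s then - ln (?d s) else 4 / sqrt t * (1 / sqrt \<bar>\<theta> - s\<bar>))"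
    proof (cases "\<theta> = s")
      case False
      have "t * (\<bar>\<theta> - s\<bar> / 2) \<le> t * cmod (cis \<theta> - cis s)"
        using \<theta> s(1) \<alpha> t by (intro mult_left_mono norm_cis_diff_ge) auto
      also have "\<dots> = cmod ((of_real t * cis \<theta> - b) - (of_real t * cis s - b))"
        using t by (simp add: norm_mult flip: right_diff_distrib)
      also have "\<dots> \<le> ?d \<theta> + ?d s" by (rule norm_triangle_ineq4)
      finally have le: "t * \<bar>\<theta> - s\<bar> / 4 \<le> ?d \<theta>" using s(2)[OF \<theta>] by linarith
      have pos: "0 < t * \<bar>\<theta> - s\<bar> / 4" using t False by simp
      have "- ln (?d \<theta>) \<le> - ln (t * \<bar>\<theta> - s\<bar> / 4)"
        using ln_mono[OF le pos] by simp
      also have "\<dots> \<le> 2 / sqrt (t * \<bar>\<theta> - s\<bar> / 4)" by (rule minus_ln_le_sqrt[OF pos])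
      also have "\<dots> = 4 / sqrt t * (1 / sqrt \<bar>\<theta> - s\<bar>)"
        by (simp add: real_sqrt_mult real_sqrt_divide)
      finally show ?thesis using False by simp
    qed simp
  qed
  also have "2 * sqrt (p + \<alpha> - s) - 2 * sqrt (p - s) = 2 * sqrt (p + \<alpha> - s) + 2 * sqrt (s - p)"
    using real_sqrt_minus[of "s - p"] by simp
  also have "4 / sqrt t * \<dots> \<le> 4 / sqrt t * (2 * sqrt \<alpha> + 2 * sqrt \<alpha>)"
    using s(1) t by (intro mult_left_mono add_mono) auto
  \<comment> \<open>The bound is kept proportional to \<alpha>, so that summing over the arcs of a
    full circle gives a multiple of 2 pi. The arc length t \<alpha> \<ge> \<kappa> removes the
    dependence on t.\<close>
  also have "\<dots> = 16 / sqrt (t * \<alpha>) * \<alpha>"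
    using \<alpha> t by (simp add: real_sqrt_mult field_simps)
  also have "\<dots> \<le> 16 / sqrt \<kappa> * \<alpha>"
    using \<alpha> \<kappa> t by (intro mult_right_mono divide_left_mono) auto
  finally show ?thesis using int by blast
qed

lemma integral_arcs_le:
  fixes \<phi> :: "real \<Rightarrow> real"
  assumes cont: "continuous_on UNIV \<phi>" and \<alpha>: "\<alpha> > 0"
    and arc: "\<And>k::nat. integral {k * \<alpha>..k * \<alpha> + \<alpha>} \<phi> \<le> C * \<alpha>"
  shows "integral {0..real n * \<alpha>} \<phi> \<le> real n * (C * \<alpha>)"
proof (induction n)
  case (Suc n)
  have "\<phi> integrable_on {0..real n * \<alpha> + \<alpha>}"
    using cont by (intro integrable_continuous_interval) (auto intro: continuous_on_subset)
  then have "integral {0..real n * \<alpha> + \<alpha>} \<phi> = integral {0..real n * \<alpha>} \<phi> + integral {real n * \<alpha>..real n * \<alpha> + \<alpha>} \<phi>"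
    using \<alpha> by (intro Henstock_Kurzweil_Integration.integral_combine[symmetric]) auto
  then show ?case using Suc arc[of n] by (simp add: algebra_simps)
qed simp

lemma has_integral_sum_list_le:
  fixes F :: "'a \<Rightarrow> real \<Rightarrow> real"
  assumes "\<And>a. a \<in> set as \<Longrightarrow> \<exists>I. (F a has_integral I) S \<and> I \<le> K"
  shows "\<exists>I. ((\<lambda>\<theta>. sum_list (map (\<lambda>a. F a \<theta>) as)) has_integral I) S \<and> I \<le> real (length as) * K"
  using assms
proof (induction as)
  case Nil
  then show ?case by auto
next
  case (Cons a as)
  obtain I where I: "(F a has_integral I) S" "I \<le> K" using Cons.prems[of a] by auto
  obtain J where J: "((\<lambda>\<theta>. sum_list (map (\<lambda>a. F a \<theta>) as)) has_integral J) S" "J \<le> real (length as) * K"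
    using Cons.IH Cons.prems by auto
  have "((\<lambda>\<theta>. F a \<theta> + sum_list (map (\<lambda>a. F a \<theta>) as)) has_integral (I + J)) S"
    using I(1) J(1) by (rule has_integral_add)
  then show ?case using I(2) J(2) by (intro exI[of _ "I + J"]) (simp add: algebra_simps)
qed

text \<open>The circle is cut into about t arcs, each inside a disc of radius s on which one list of
  at most N points controls u. An arc of angle \<alpha> contributes O(\<alpha>), and the angles add
  up to 2 pi whatever the number of arcs.\<close>

lemma circle_integral_bound:
  fixes u :: "complex \<Rightarrow> real"
  assumes s: "s > 0" and B: "B \<ge> 0"
    and loc: "\<And>w. \<exists>as. length as \<le> N \<and> (\<forall>z\<in>ball w s. z \<notin> Z \<longrightarrow>
        (\<forall>a\<in>set as. z \<noteq> a) \<and>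
        \<bar>u z\<bar> \<le> B - sum_list (map (\<lambda>a. ln (cmod (z - a))) as))"
  shows "\<exists>C. \<forall>c t. 1 \<le> t \<longrightarrow> (\<forall>\<theta>. c + of_real t * cis \<theta> \<notin> Z) \<longrightarrow>
     continuous_on UNIV (\<lambda>\<theta>. u (c + of_real t * cis \<theta>)) \<longrightarrow>
     integral {0..2*pi} (\<lambda>\<theta>. \<bar>u (c + of_real t * cis \<theta>)\<bar>) \<le> C"
proof -
  \<comment> \<open>This is a lower bound for the arc length: the number n of arcs is at most 2 pi t
    / s + 8, and t \<ge> 1 makes this at most t (2 pi / s + 8).\<close>
  define \<kappa> where "\<kappa> = 2 * pi / (2 * pi / s + 8)"
  have \<kappa>: "\<kappa> > 0" using s by (simp add: \<kappa>_def add_pos_pos)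
  define C where "C = B + real N * (16 / sqrt \<kappa>)"
  show ?thesis
  proof (intro exI allI impI)
    fix c :: complex and t :: real
    assume t: "1 \<le> t" and Z: "\<forall>\<theta>. c + of_real t * cis \<theta> \<notin> Z"
      and cont: "continuous_on UNIV (\<lambda>\<theta>. u (c + of_real t * cis \<theta>))"
    let ?\<phi> = "\<lambda>\<theta>. \<bar>u (c + of_real t * cis \<theta>)\<bar>"
    \<comment> \<open>The ceiling makes the arcs shorter than s. The summand 7 exceeds 2 pi, so the
      angle \<alpha> is at most 1 even for large s.\<close>
    define n where "n = nat \<lceil>2 * pi * t / s\<rceil> + 7"
    define \<alpha> where "\<alpha> = 2 * pi / real n"
    have x0: "0 \<le> 2 * pi * t / s" using t s by simp
    have n: "2 * pi * t / s < real n" "real n \<le> 2 * pi * t / s + 8" "real n \<ge> 7"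
      using x0 unfolding n_def by linarith+
    have n0: "real n > 0" using n by linarith
    have \<alpha>0: "\<alpha> > 0" using n0 by (simp add: \<alpha>_def)
    have \<alpha>1: "\<alpha> \<le> 1" using n0 n pi_less_4 pi_approx by (simp add: \<alpha>_def field_simps)
    have t\<alpha>: "t * \<alpha> < s" using n(1) s n0 by (simp add: \<alpha>_def field_simps)
    have "real n \<le> t * (2 * pi / s + 8)"
      using n(2) t by (simp add: distrib_left mult.commute)
    then have "2 * pi * t / (t * (2 * pi / s + 8)) \<le> 2 * pi * t / real n"
      using n0 t s by (intro divide_left_mono mult_pos_pos) (auto intro!: add_pos_pos)
    then have \<kappa>\<alpha>: "\<kappa> \<le> t * \<alpha>" using t by (simp add: \<kappa>_def \<alpha>_def mult.commute)
    have contabs: "continuous_on UNIV ?\<phi>" using cont by (intro continuous_intros)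
    have arc: "integral {k * \<alpha>..k * \<alpha> + \<alpha>} ?\<phi> \<le> C * \<alpha>" for k :: nat
    proof -
      let ?p = "real k * \<alpha>"
      let ?w = "c + of_real t * cis ?p"
      obtain as where as: "length as \<le> N" "\<And>z. z \<in> ball ?w s \<Longrightarrow> z \<notin> Z \<Longrightarrow>
        (\<forall>a\<in>set as. z \<noteq> a) \<and> \<bar>u z\<bar> \<le> B - sum_list (map (\<lambda>a. ln (cmod (z - a))) as)"
        using loc[of ?w] by blast
      have inb: "c + of_real t * cis \<theta> \<in> ball ?w s" if "\<theta> \<in> {?p..?p+\<alpha>}" for \<theta>
      proof -
        have "cmod (cis ?p - cis \<theta>) \<le> \<bar>?p - \<theta>\<bar>"
          by (rule norm_cis_diff_le)
        also have "\<dots> \<le> \<alpha>" using that by auto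
        finally have "t * cmod (cis ?p - cis \<theta>) \<le> t * \<alpha>" using t by simp
        moreover have "dist ?w (c + of_real t * cis \<theta>) = t * cmod (cis ?p - cis \<theta>)"
          using t by (simp add: dist_norm norm_mult flip: right_diff_distrib)
        ultimately show ?thesis using t\<alpha> by simp
      qed
      have "\<exists>I. ((\<lambda>\<theta>. sum_list (map (\<lambda>a. - ln (cmod (of_real t * cis \<theta> - (a - c)))) as)) has_integral I) {?p..?p+\<alpha>}
              \<and> I \<le> real (length as) * (16 / sqrt \<kappa> * \<alpha>)"
      proof (rule has_integral_sum_list_le, rule arc_integral_bound[OF \<alpha>0 \<alpha>1 \<kappa> \<kappa>\<alpha>])
        fix a \<theta> assume a: "a \<in> set as" and \<theta>: "\<theta> \<in> {?p..?p+\<alpha>}"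
        have "c + of_real t * cis \<theta> \<noteq> a" using as(2)[OF inb[OF \<theta>]] Z a by blast
        then show "of_real t * cis \<theta> \<noteq> a - c" by (auto simp: algebra_simps)
      qed
      then obtain I where I: "((\<lambda>\<theta>. sum_list (map (\<lambda>a. - ln (cmod (of_real t * cis \<theta> - (a - c)))) as)) has_integral I) {?p..?p+\<alpha>}"
        "I \<le> real (length as) * (16 / sqrt \<kappa> * \<alpha>)" by blast
      have "((\<lambda>\<theta>. B) has_integral \<alpha> * B) {?p..?p+\<alpha>}"
        using has_integral_const_real[of B ?p "?p+\<alpha>"] \<alpha>0 by simp
      from has_integral_add[OF this I(1)]
      have maj: "((\<lambda>\<theta>. B + sum_list (map (\<lambda>a. - ln (cmod (of_real t * cis \<theta> - (a - c)))) as)) has_integral (\<alpha> * B + I)) {?p..?p+\<alpha>}" .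
      have "?\<phi> integrable_on {?p..?p+\<alpha>}"
        using contabs by (intro integrable_continuous_interval) (auto intro: continuous_on_subset)
      then have "(?\<phi> has_integral integral {?p..?p+\<alpha>} ?\<phi>) {?p..?p+\<alpha>}"
        by (rule integrable_integral)
      then have "integral {?p..?p+\<alpha>} ?\<phi> \<le> \<alpha> * B + I"
      proof (rule has_integral_le[OF _ maj])
        fix \<theta> assume \<theta>: "\<theta> \<in> {?p..?p+\<alpha>}"
        have "sum_list (map (\<lambda>a. - ln (cmod (of_real t * cis \<theta> - (a - c)))) as)
            = - sum_list (map (\<lambda>a. ln (cmod (c + of_real t * cis \<theta> - a))) as)"
          by (induction as) (simp_all add: algebra_simps)
        then show "?\<phi> \<theta> \<le> B + sum_list (map (\<lambda>a. - ln (cmod (of_real t * cis \<theta> - (a - c)))) as)"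
          using as(2)[OF inb[OF \<theta>]] Z by simp
      qed
      also have "\<dots> \<le> \<alpha> * B + real N * (16 / sqrt \<kappa> * \<alpha>)"
      proof -
        have "real (length as) * (16 / sqrt \<kappa> * \<alpha>) \<le> real N * (16 / sqrt \<kappa> * \<alpha>)"
          using as(1) \<kappa> \<alpha>0 by (intro mult_right_mono) auto
        then show ?thesis using I(2) by linarith
      qed
      also have "\<dots> = C * \<alpha>" by (simp add: C_def algebra_simps)
      finally show ?thesis .
    qed
    have "integral {0..real n * \<alpha>} ?\<phi> \<le> real n * (C * \<alpha>)"
      by (rule integral_arcs_le[OF contabs \<alpha>0 arc])
    moreover have "real n * \<alpha> = 2 * pi" using n0 by (simp add: \<alpha>_def)
    ultimately show "integral {0..2*pi} ?\<phi> \<le> 2 * pi * C"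
      by (metis mult.assoc mult.commute)
  qed
qed

subsection \<open>Factorization and the Jensen formulas\<close>

text \<open>Off z0 the two forms give g = (z - z0)^k g' with k > 0, and the limit at z0 contradicts
  g z0 \<noteq> 0. Used in both directions, this makes the order unique, so that the description in
  \<open>mord\<close> denotes it.\<close>

lemma local_rep_not_less:
  assumes "local_rep f z0 m" "local_rep f z0 m'"
  shows "\<not> m < m'"
proof
  assume less: "m < m'"
  obtain r g where r: "r > 0" "g holomorphic_on ball z0 r" "g z0 \<noteq> 0"
    and f: "\<And>z. z \<in> ball z0 r \<Longrightarrow> f z = (if z = z0 \<and> m < 0 then None else Some ((z - z0) powi m * g z))"
    using assms(1) unfolding local_rep_def by blast
  obtain r' g' where r': "r' > 0" "g' holomorphic_on ball z0 r'"
    and f': "\<And>z. z \<in> ball z0 r' \<Longrightarrow> f z = (if z = z0 \<and> m' < 0 then None else Some ((z - z0) powi m' * g' z))"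
    using assms(2) unfolding local_rep_def by blast
  define k where "k = nat (m' - m)"
  have k: "k > 0" "m' = m + int k" using less by (simp_all add: k_def)
  have lim: "(g \<longlongrightarrow> g z0) (at z0)" "(g' \<longlongrightarrow> g' z0) (at z0)"
    using isCont_holomorphic_ball[OF r(2,1)] isCont_holomorphic_ball[OF r'(2,1)] by (auto simp: isCont_def)
  have "((\<lambda>z. (z - z0) ^ k * g' z) \<longlongrightarrow> (z0 - z0) ^ k * g' z0) (at z0)"
    by (intro tendsto_intros lim)
  moreover have "eventually (\<lambda>z. (z - z0) ^ k * g' z = g z) (at z0)"
    unfolding eventually_at
  proof (intro exI[of _ "min r r'"] conjI ballI impI)
    show "0 < min r r'" using r r' by simp
    fix z assume "z \<noteq> z0 \<and> dist z z0 < min r r'"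
    then have z: "z - z0 \<noteq> 0" "z \<in> ball z0 r" "z \<in> ball z0 r'" by (auto simp: dist_commute)
    have "(z - z0) powi m' * g' z = (z - z0) powi m * g z"
      using f[OF z(2)] f'[OF z(3)] z(1) by simp
    moreover have "(z - z0) powi m' = (z - z0) powi m * (z - z0) ^ k"
      using z(1) by (simp add: k(2) power_int_add)
    ultimately show "(z - z0) ^ k * g' z = g z" using z(1) by simp
  qed
  ultimately have "(g \<longlongrightarrow> (z0 - z0) ^ k * g' z0) (at z0)"
    by (rule Lim_transform_eventually)
  then have "g z0 = (z0 - z0) ^ k * g' z0"
    using lim(1) by (intro tendsto_unique[of "at z0"]) auto
  then show False using k(1) r(3) by simp
qed

lemma local_rep_mord:
  assumes "meromorphic_C f"
  shows "local_rep f z (mord f z)"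
proof -
  obtain m where m: "local_rep f z m" using assms by (auto simp: meromorphic_C_def)
  moreover have "m' = m" if "local_rep f z m'" for m'
    using local_rep_not_less[OF m that] local_rep_not_less[OF that m] by simp
  ultimately show ?thesis unfolding mord_def by (rule theI)
qed

lemma mord_sign:
  assumes "meromorphic_C f"
  shows "f z = None \<longleftrightarrow> mord f z < 0" "f z = Some 0 \<longleftrightarrow> mord f z > 0"
proof -
  obtain r g where "r > 0" "g z \<noteq> 0"
    and f: "\<And>w. w \<in> ball z r \<Longrightarrow> f w = (if w = z \<and> mord f z < 0 then None else Some ((w - z) powi mord f z * g w))"
    using local_rep_mord[OF assms, of z] unfolding local_rep_def by blast
  then show "f z = None \<longleftrightarrow> mord f z < 0" "f z = Some 0 \<longleftrightarrow> mord f z > 0"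
    using f[of z] by (auto simp: power_int_0_left_if split: if_splits)
qed

lemma local_rep_isolated:
  assumes f: "meromorphic_C f"
  shows "\<exists>r>0. \<exists>g. g holomorphic_on ball z0 r \<and> (\<forall>z\<in>ball z0 r. g z \<noteq> 0) \<and>
    (\<forall>z\<in>ball z0 r. z \<noteq> z0 \<longrightarrow> f z = Some ((z - z0) powi mord f z0 * g z) \<and> mord f z = 0)
    \<and> (mord f z0 = 0 \<longrightarrow> f z0 = Some (g z0))"
proof -
  obtain r g where r: "r > 0" "g holomorphic_on ball z0 r" "g z0 \<noteq> 0"
    and fz: "\<And>z. z \<in> ball z0 r \<Longrightarrow> f z = (if z = z0 \<and> mord f z0 < 0 then None else Some ((z - z0) powi mord f z0 * g z))"
    using local_rep_mord[OF f, of z0] unfolding local_rep_def by blast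
  obtain d where d: "d > 0" "\<And>z. dist z0 z < d \<Longrightarrow> g z \<noteq> 0"
    using continuous_at_avoid[OF isCont_holomorphic_ball[OF r(2,1)] r(3)] by blast
  show ?thesis
  proof (intro exI[of _ "min r d"] exI[of _ g] conjI ballI impI)
    show "0 < min r d" using r d by simp
    show "g holomorphic_on ball z0 (min r d)" by (rule holomorphic_on_subset[OF r(2)]) auto
    show "g z \<noteq> 0" if "z \<in> ball z0 (min r d)" for z using that d by simp
    show "f z0 = Some (g z0)" if "mord f z0 = 0" using fz[of z0] r that by simp
    fix z assume z: "z \<in> ball z0 (min r d)" "z \<noteq> z0"
    show eq: "f z = Some ((z - z0) powi mord f z0 * g z)" using fz[of z] z by simp
    have "g z \<noteq> 0" using d z by simp
    then have "f z \<noteq> None" "f z \<noteq> Some 0" using eq z by auto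
    then show "mord f z = 0" using mord_sign[OF f, of z] by simp
  qed
qed

lemma finite_divisor:
  assumes f: "meromorphic_C f"
  shows "finite {a \<in> cball c R. mord f a \<noteq> 0}"
proof -
  have "\<not> z islimpt {a. mord f a \<noteq> 0}" for z
  proof -
    obtain r where "r > 0" "\<And>w. w \<in> ball z r \<Longrightarrow> w \<noteq> z \<Longrightarrow> mord f w = 0"
      using local_rep_isolated[OF f, of z] by blast
    then show ?thesis by (auto simp: islimpt_approachable dist_commute)
  qed
  then have "finite (cball c R \<inter> {a. mord f a \<noteq> 0})"
    by (intro finite_not_islimpt_in_compact) auto
  then show ?thesis by (simp add: Int_def)
qed

text \<open>The value of G at z is the local factor of f at z itself, divided by the linear factors
  of the other points of A; this is already the right value at zeros and poles. Near z0 every other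
  point has order 0, so G agrees there with the single quotient built from the factor at z0 and is
  holomorphic.\<close>

lemma meromorphic_factorization:
  fixes c :: complex and R :: real
  assumes f: "meromorphic_C f"
  defines "A \<equiv> {a \<in> cball c R. mord f a \<noteq> 0}"
  shows "\<exists>G. G holomorphic_on ball c R \<and> (\<forall>z\<in>ball c R. G z \<noteq> 0) \<and>
    (\<forall>z\<in>ball c R - A. f z = Some ((\<Prod>a\<in>A. (z - a) powi mord f a) * G z))"
proof -
  have fin: "finite A" unfolding A_def by (rule finite_divisor[OF f])
  have "\<forall>z0. \<exists>p. fst p > 0 \<and> (snd p) holomorphic_on ball z0 (fst p) \<and> (\<forall>z\<in>ball z0 (fst p). snd p z \<noteq> 0) \<and>
    (\<forall>z\<in>ball z0 (fst p). z \<noteq> z0 \<longrightarrow> f z = Some ((z - z0) powi mord f z0 * snd p z) \<and> mord f z = 0)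
    \<and> (mord f z0 = 0 \<longrightarrow> f z0 = Some (snd p z0))"
    using local_rep_isolated[OF f] by simp
  then obtain p where p: "\<forall>z0. fst (p z0) > 0 \<and> (snd (p z0)) holomorphic_on ball z0 (fst (p z0)) \<and> (\<forall>z\<in>ball z0 (fst (p z0)). snd (p z0) z \<noteq> 0) \<and>
    (\<forall>z\<in>ball z0 (fst (p z0)). z \<noteq> z0 \<longrightarrow> f z = Some ((z - z0) powi mord f z0 * snd (p z0) z) \<and> mord f z = 0)
    \<and> (mord f z0 = 0 \<longrightarrow> f z0 = Some (snd (p z0) z0))"
    by (rule choice[THEN exE])
  define r where "r z0 = fst (p z0)" for z0
  define g where "g z0 = snd (p z0)" for z0
  have r: "r z0 > 0" and g: "g z0 holomorphic_on ball z0 (r z0)" and g0: "z \<in> ball z0 (r z0) \<Longrightarrow> g z0 z \<noteq> 0"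
    and fz: "z \<in> ball z0 (r z0) \<Longrightarrow> z \<noteq> z0 \<Longrightarrow> f z = Some ((z - z0) powi mord f z0 * g z0 z)"
    and m0: "z \<in> ball z0 (r z0) \<Longrightarrow> z \<noteq> z0 \<Longrightarrow> mord f z = 0"
    and f0: "mord f z0 = 0 \<Longrightarrow> f z0 = Some (g z0 z0)" for z z0
    using p by (simp_all add: r_def g_def)
  define Q where "Q = (\<lambda>B z. \<Prod>a\<in>B. (z - a) powi mord f a)"
  define G where "G = (\<lambda>z. g z z / Q (A - {z}) z)"
  have Q0: "Q B z \<noteq> 0" if "z \<notin> B" "B \<subseteq> A" for B z
    using that fin finite_subset[OF that(2)] by (auto simp: Q_def)
  have loc: "G z = g z0 z / Q (A - {z0}) z" if z0: "z0 \<in> ball c R" and z: "z \<in> ball z0 (r z0)" for z z0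
  proof (cases "z = z0")
    case True
    then show ?thesis by (simp add: G_def)
  next
    case False
    have mz: "mord f z = 0" by (rule m0[OF z False])
    then have "z \<notin> A" by (simp add: A_def)
    then have Gz: "G z = g z z / Q A z" by (simp add: G_def)
    have gz: "g z z = (z - z0) powi mord f z0 * g z0 z"
      using f0[OF mz] fz[OF z False] by simp
    have "Q A z = (z - z0) powi mord f z0 * Q (A - {z0}) z"
    proof (cases "z0 \<in> A")
      case True
      then show ?thesis unfolding Q_def by (rule prod.remove[OF fin])
    next
      case z0A: False
      then have "mord f z0 = 0" using z0 by (auto simp: A_def)
      then show ?thesis using z0A by simp
    qed
    then show ?thesis using False by (simp add: Gz gz)
  qed
  have diff: "G field_differentiable (at z0)" if z0: "z0 \<in> ball c R" for z0
  proof -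
    have nin: "z \<notin> A - {z0}" if "z \<in> ball z0 (r z0)" for z
      using m0[OF that] by (auto simp: A_def)
    have "(\<lambda>z. g z0 z / Q (A - {z0}) z) holomorphic_on ball z0 (r z0)"
    proof (rule holomorphic_on_divide[OF g])
      show "Q (A - {z0}) holomorphic_on ball z0 (r z0)"
        unfolding Q_def using nin by (intro holomorphic_intros) auto
      show "Q (A - {z0}) z \<noteq> 0" if "z \<in> ball z0 (r z0)" for z
        by (rule Q0[OF nin[OF that]]) auto
    qed
    then have "G holomorphic_on ball z0 (r z0)"
      by (rule holomorphic_transform) (simp add: loc[OF z0])
    then show ?thesis
      by (rule holomorphic_on_imp_differentiable_at) (use r in auto)
  qed
  show ?thesis
  proof (intro exI[of _ G] conjI ballI)
    show "G holomorphic_on ball c R"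
      using diff by (simp add: field_differentiable_at_within holomorphic_on_def)
    show "G z \<noteq> 0" for z using g0[of z z] r[of z] Q0[of z "A - {z}"] by (simp add: G_def)
    fix z assume z: "z \<in> ball c R - A"
    then have "mord f z = 0" by (auto simp: A_def)
    then have "f z = Some (g z z)" by (rule f0)
    moreover have "Q A z \<noteq> 0" using z by (intro Q0) auto
    moreover have Q: "(\<Prod>a\<in>A. (z - a) powi mord f a) = Q A z" by (simp add: Q_def)
    ultimately show "f z = Some ((\<Prod>a\<in>A. (z - a) powi mord f a) * G z)"
      using z by (simp add: G_def Q)
  qed
qed

lemma ln_powi: "x > 0 \<Longrightarrow> ln (x powi m) = of_int m * ln (x::real)"
  by (cases m rule: int_cases4) (simp_all add: power_int_minus ln_inverse ln_realpow)

text \<open>The numbers \<open>p\<close> and \<open>q\<close> are the real part and the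
  conjugate derivative, at the centre, of the logarithm of the zero-free factor.\<close>
lemma Jensen_moments:
  fixes c :: complex and R :: real
  assumes f: "meromorphic_C f"
  defines "A \<equiv> {a \<in> cball c R. mord f a \<noteq> 0}"
  shows "\<exists>p q. \<forall>t. 0 < t \<longrightarrow> t < R \<longrightarrow> (\<forall>a\<in>A. cmod (a - c) \<noteq> t) \<longrightarrow>
     continuous_on UNIV (\<lambda>\<theta>. ln (cmod (cval (f (c + of_real t * cis \<theta>))))) \<and>
     ((\<lambda>\<theta>. ln (cmod (cval (f (c + of_real t * cis \<theta>))))) has_integral
        2 * pi * ((\<Sum>a\<in>A. of_int (mord f a) * ln (max t (cmod (a - c)))) + p)) {0..2*pi} \<and>
     ((\<lambda>\<theta>. of_real (ln (cmod (cval (f (c + of_real t * cis \<theta>))))) * cis \<theta>) has_integral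
        of_real pi * (of_real t * q - (\<Sum>a\<in>A. of_int (mord f a) * ((a - c) * of_real (t / (max t (cmod (a - c)))\<^sup>2))))) {0..2*pi}"
proof -
  have fin: "finite A" unfolding A_def by (rule finite_divisor[OF f])
  obtain G where G: "G holomorphic_on ball c R" "\<And>z. z \<in> ball c R \<Longrightarrow> G z \<noteq> 0"
    "\<And>z. z \<in> ball c R - A \<Longrightarrow> f z = Some ((\<Prod>a\<in>A. (z - a) powi mord f a) * G z)"
    using meromorphic_factorization[OF f, of c R] unfolding A_def by blast
  obtain h where h: "h holomorphic_on ball c R" "\<And>z. z \<in> ball c R \<Longrightarrow> G z = exp (h z)"
    using contractible_imp_holomorphic_log[OF G(1) convex_imp_contractible[OF convex_ball] G(2)] by blast
  define k where "k = (\<lambda>w. h (c + w))"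
  have "(h \<circ> (\<lambda>w. c + w)) holomorphic_on ball 0 R"
    by (rule holomorphic_on_compose_gen[OF _ h(1)]) (auto intro!: holomorphic_intros simp: dist_norm)
  then have k: "k holomorphic_on ball 0 R" by (simp add: k_def o_def)
  show ?thesis
  proof (intro exI[of _ "Re (k 0)"] exI[of _ "cnj (deriv k 0)"] allI impI)
    fix t assume t: "0 < t" "t < R" and gen: "\<forall>a\<in>A. cmod (a - c) \<noteq> t"
    let ?u = "\<lambda>\<theta>. ln (cmod (cval (f (c + of_real t * cis \<theta>))))"
    let ?v = "\<lambda>\<theta>. (\<Sum>a\<in>A. of_int (mord f a) * ln (cmod (of_real t * cis \<theta> - (a - c)))) + Re (k (of_real t * cis \<theta>))"
    have ball: "of_real t * cis \<theta> \<in> ball 0 R" for \<theta> using t by (simp add: norm_mult)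
    have ne: "of_real t * cis \<theta> - (a - c) \<noteq> 0" if "a \<in> A" for a \<theta>
    proof
      assume "of_real t * cis \<theta> - (a - c) = 0"
      then have "cmod (a - c) = cmod (of_real t * cis \<theta>)" by simp
      then show False using gen that t by (simp add: norm_mult)
    qed
    have u: "?u = ?v"
    proof
      fix \<theta>
      let ?z = "c + of_real t * cis \<theta>"
      have zA: "?z \<notin> A" using ne[of ?z \<theta>] by auto
      have zb: "?z \<in> ball c R" using ball[of \<theta>] by (simp add: dist_norm)
      have "cmod (cval (f ?z)) = (\<Prod>a\<in>A. cmod (?z - a) powi mord f a) * exp (Re (k (of_real t * cis \<theta>)))"
        using G(3)[of ?z] zA zb by (simp add: norm_mult prod_norm[symmetric] norm_power_int h(2) k_def)
      moreover have pos: "cmod (?z - a) > 0" if "a \<in> A" for a using ne[OF that, of \<theta>] by (simp add: algebra_simps)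
      moreover have "(\<Prod>a\<in>A. cmod (?z - a) powi mord f a) \<noteq> 0"
        using pos fin by auto
      ultimately have "?u \<theta> = ln (\<Prod>a\<in>A. cmod (?z - a) powi mord f a) + Re (k (of_real t * cis \<theta>))"
        by (simp add: ln_mult)
      also have "ln (\<Prod>a\<in>A. cmod (?z - a) powi mord f a) = (\<Sum>a\<in>A. of_int (mord f a) * ln (cmod (?z - a)))"
        using pos fin by (subst ln_prod) (auto intro!: sum.cong ln_powi)
      finally show "?u \<theta> = ?v \<theta>" by (simp add: algebra_simps)
    qed
    have "continuous_on UNIV (\<lambda>\<theta>. k (of_real t * cis \<theta>))"
      by (rule continuous_on_compose2[OF holomorphic_on_imp_continuous_on[OF k]]) (use ball in \<open>auto intro!: continuous_intros\<close>)
    then have "continuous_on UNIV ?v"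
      using ne by (intro continuous_intros) auto
    then have 1: "continuous_on UNIV ?u" by (simp only: u)
    have "(?v has_integral (\<Sum>a\<in>A. of_int (mord f a) * (2 * pi * ln (max t (cmod (a - c))))) + 2 * pi * Re (k 0)) {0..2*pi}"
      using gen fin t by (intro has_integral_add has_integral_sum has_integral_mult_right ln_norm_circle(1) Re_mean_circle[OF k]) auto
    then have 2: "(?u has_integral 2 * pi * ((\<Sum>a\<in>A. of_int (mord f a) * ln (max t (cmod (a - c)))) + Re (k 0))) {0..2*pi}"
      by (simp only: u) (simp add: distrib_left sum_distrib_left mult_ac)
    have "((\<lambda>\<theta>. (\<Sum>a\<in>A. of_int (mord f a) * (of_real (ln (cmod (of_real t * cis \<theta> - (a - c)))) * cis \<theta>)) + of_real (Re (k (of_real t * cis \<theta>))) * cis \<theta>)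
       has_integral (\<Sum>a\<in>A. of_int (mord f a) * (- of_real pi * ((a - c) * of_real t / of_real ((max t (cmod (a - c)))\<^sup>2))))
         + of_real pi * of_real t * cnj (deriv k 0)) {0..2*pi}"
      using gen fin t by (intro has_integral_add has_integral_sum has_integral_mult_right ln_norm_circle(2) Re_moment_circle[OF k]) auto
    moreover have "(\<lambda>\<theta>. (\<Sum>a\<in>A. of_int (mord f a) * (of_real (ln (cmod (of_real t * cis \<theta> - (a - c)))) * cis \<theta>)) + of_real (Re (k (of_real t * cis \<theta>))) * cis \<theta>)
       = (\<lambda>\<theta>. of_real (?u \<theta>) * cis \<theta>)"
      unfolding fun_cong[OF u] by (simp add: distrib_right sum_distrib_right mult.assoc)
    moreover have "(\<Sum>a\<in>A. of_int (mord f a) * (- of_real pi * ((a - c) * of_real t / of_real ((max t (cmod (a - c)))\<^sup>2))))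
         + of_real pi * of_real t * cnj (deriv k 0) = of_real pi * (of_real t * cnj (deriv k 0)
           - (\<Sum>a\<in>A. of_int (mord f a) * ((a - c) * of_real (t / (max t (cmod (a - c)))\<^sup>2))))"
    proof -
      have "(\<Sum>a\<in>A. of_int (mord f a) * (- of_real pi * ((a - c) * of_real t / of_real ((max t (cmod (a - c)))\<^sup>2))))
        = - (of_real pi * (\<Sum>a\<in>A. of_int (mord f a) * ((a - c) * of_real (t / (max t (cmod (a - c)))\<^sup>2))))"
        unfolding sum_distrib_left sum_negf[symmetric] by (intro sum.cong) (simp_all add: mult_ac)
      then show ?thesis by (simp add: right_diff_distrib)
    qed
    ultimately have 3: "((\<lambda>\<theta>. of_real (?u \<theta>) * cis \<theta>) has_integral of_real pi * (of_real t * cnj (deriv k 0)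
           - (\<Sum>a\<in>A. of_int (mord f a) * ((a - c) * of_real (t / (max t (cmod (a - c)))\<^sup>2))))) {0..2*pi}"
      by (simp only:)
    show "continuous_on UNIV ?u \<and>
       (?u has_integral 2 * pi * ((\<Sum>a\<in>A. of_int (mord f a) * ln (max t (cmod (a - c)))) + Re (k 0))) {0..2*pi} \<and>
       ((\<lambda>\<theta>. of_real (?u \<theta>) * cis \<theta>) has_integral of_real pi * (of_real t * cnj (deriv k 0)
           - (\<Sum>a\<in>A. of_int (mord f a) * ((a - c) * of_real (t / (max t (cmod (a - c)))\<^sup>2))))) {0..2*pi}"
      using 1 2 3 by (intro conjI)
  qed
qed

subsection \<open>Local bounds for the class \<open>N\<^sub>1\<close>\<close>

definition norm_le :: "real \<Rightarrow> complex option \<Rightarrow> bool" where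
  "norm_le k x \<longleftrightarrow> (\<exists>u. x = Some u \<and> cmod u \<le> k)"

lemma norm_le_one_cases: "norm_le 1 x \<or> norm_le 1 (sinv x)"
proof (cases x)
  case None
  then show ?thesis by (simp add: norm_le_def sinv_def)
next
  case (Some v)
  then show ?thesis by (auto simp: norm_le_def sinv_def norm_inverse inverse_le_1_iff)
qed

text \<open>Passing from modulus at most 1 to modulus above 2 costs spherical distance at least 1/2,
  so uniform continuity gives one radius for all centres.\<close>

lemma normal_fn_norm_le:
  assumes "meromorphic_C f" "normal_fn f"
  shows "\<exists>\<delta>>0. \<forall>w z. dist w z < \<delta> \<longrightarrow> (norm_le 1 (f w) \<longrightarrow> norm_le 2 (f z)) \<and>
    (norm_le 1 (sinv (f w)) \<longrightarrow> norm_le 2 (sinv (f z)))"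
proof -
  have step: "norm_le 2 y" if "rhoS x y < 1/2" "norm_le 1 x" for x y
    using rhoS_near_bounded[of _ y] that by (auto simp: norm_le_def)
  obtain \<delta> where \<delta>: "\<delta> > 0" "\<And>w z. dist w z < \<delta> \<Longrightarrow> rhoS (f w) (f z) < 1/2"
    using normal_fn_uniformly_continuous[OF assms, of "1/2"] by auto
  have "norm_le 2 (f z)" if "dist w z < \<delta>" "norm_le 1 (f w)" for w z
    by (rule step[OF \<delta>(2)[OF that(1)] that(2)])
  moreover have "norm_le 2 (sinv (f z))" if d: "dist w z < \<delta>" "norm_le 1 (sinv (f w))" for w z
    by (rule step[OF _ d(2)]) (use \<delta>(2)[OF d(1)] in simp)
  ultimately show ?thesis using \<delta>(1) by blast
qed

text \<open>Otherwise there are centres h k such that f is within 1/(k+1) of 0 on the disc of radius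
  k about h k, and the translates by h converge to the constant 0.\<close>

lemma class_N1_not_uniformly_small:
  assumes "class_N1 f"
  shows "\<exists>k::nat. \<forall>w. \<exists>z\<in>cball w (real k). 1 / real (Suc k) \<le> rhoS (f z) (Some 0)"
proof (rule ccontr)
  assume "\<not> ?thesis"
  then have "\<forall>k. \<exists>w. \<forall>z\<in>cball w (real k). rhoS (f z) (Some 0) < 1 / real (Suc k)"
    by (simp add: not_le)
  then obtain h where h: "\<forall>k. \<forall>z\<in>cball (h k) (real k). rhoS (f z) (Some 0) < 1 / real (Suc k)"
    by (rule choice[THEN exE])
  have "translates_converge f h (\<lambda>_. Some 0)"
    unfolding translates_converge_def
  proof (intro allI impI)
    fix K :: "complex set" and \<epsilon> :: real
    assume K: "compact K" and \<epsilon>: "\<epsilon> > 0"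
    obtain M where M: "\<And>z. z \<in> K \<Longrightarrow> cmod z \<le> M"
      using compact_imp_bounded[OF K] by (auto simp: bounded_iff)
    obtain N1 :: nat where N1: "M \<le> real N1" using real_arch_simple by blast
    obtain N2 :: nat where N2: "1 / real (Suc N2) < \<epsilon>" using nat_approx_posE[OF \<epsilon>] by blast
    show "\<exists>N. \<forall>n\<ge>N. \<forall>z\<in>K. rhoS (f (z + h n)) (Some 0) < \<epsilon>"
    proof (intro exI[of _ "max N1 N2"] allI impI ballI)
      fix n z assume n: "max N1 N2 \<le> n" and z: "z \<in> K"
      have "cmod z \<le> real n" using M[OF z] N1 n by simp
      then have "z + h n \<in> cball (h n) (real n)" by (simp add: dist_norm)
      then have "rhoS (f (z + h n)) (Some 0) < 1 / real (Suc n)" using h by blast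
      also have "\<dots> \<le> 1 / real (Suc N2)" using n by (intro divide_left_mono) auto
      finally show "rhoS (f (z + h n)) (Some 0) < \<epsilon>" using N2 by linarith
    qed
  qed
  then show False using assms unfolding class_N1_def by blast
qed

section \<open>Propagation of smallness from a disc to larger discs\<close>

text \<open>Counterexamples for \<epsilon> = 1/(n+1), moved to the origin, have a locally uniform
  limit by Montel's theorem. It vanishes on the small disc, hence on all of
  \<open>ball 0 \<delta>\<close>, and uniform convergence on the closed disc of radius 2s, compact
  in it, contradicts the lower bound \<eta>.\<close>

lemma holomorphic_small_propagates:
  assumes s: "0 < s" "2 * s < \<delta>" and \<eta>: "\<eta> > 0"
  shows "\<exists>\<epsilon>>0. \<forall>x F. F holomorphic_on ball x \<delta> \<longrightarrow> (\<forall>z\<in>ball x \<delta>. cmod (F z) \<le> 2) \<longrightarrow>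
    (\<forall>z\<in>ball x s. cmod (F z) < \<epsilon>) \<longrightarrow> (\<forall>z\<in>ball x (2 * s). cmod (F z) < \<eta>)"
proof (rule ccontr)
  assume neg: "\<not> ?thesis"
  have "\<exists>H z. H holomorphic_on ball 0 \<delta> \<and> (\<forall>z\<in>ball 0 \<delta>. cmod (H z) \<le> 2) \<and>
     (\<forall>z\<in>ball 0 s. cmod (H z) < 1 / real (Suc n)) \<and> z \<in> cball 0 (2 * s) \<and> \<eta> \<le> cmod (H z)" for n :: nat
  proof -
    have "1 / real (Suc n) > 0" by simp
    then obtain x F z where F: "F holomorphic_on ball x \<delta>" "\<forall>z\<in>ball x \<delta>. cmod (F z) \<le> 2"
      "\<forall>z\<in>ball x s. cmod (F z) < 1 / real (Suc n)" "z \<in> ball x (2 * s)" "\<not> cmod (F z) < \<eta>"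
      using neg by blast
    have "(F \<circ> (\<lambda>z. x + z)) holomorphic_on ball 0 \<delta>"
      by (rule holomorphic_on_compose_gen[OF _ F(1)]) (auto intro!: holomorphic_intros simp: dist_norm)
    then show ?thesis
      by (intro exI[of _ "\<lambda>z. F (x + z)"] exI[of _ "z - x"])
         (use F(2-5) in \<open>auto simp: o_def dist_norm norm_minus_commute\<close>)
  qed
  then have "\<forall>n::nat. \<exists>p. fst p holomorphic_on ball 0 \<delta> \<and> (\<forall>z\<in>ball 0 \<delta>. cmod (fst p z) \<le> 2) \<and>
     (\<forall>z\<in>ball 0 s. cmod (fst p z) < 1 / real (Suc n)) \<and> snd p \<in> cball 0 (2 * s) \<and> \<eta> \<le> cmod (fst p (snd p))"
    by simp
  then obtain p where p: "\<forall>n::nat. fst (p n) holomorphic_on ball 0 \<delta> \<and> (\<forall>z\<in>ball 0 \<delta>. cmod (fst (p n) z) \<le> 2) \<and>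
     (\<forall>z\<in>ball 0 s. cmod (fst (p n) z) < 1 / real (Suc n)) \<and> snd (p n) \<in> cball 0 (2 * s) \<and> \<eta> \<le> cmod (fst (p n) (snd (p n)))"
    by (rule choice[THEN exE])
  define H where "H n = fst (p n)" for n
  define \<zeta> where "\<zeta> n = snd (p n)" for n
  have H: "H n holomorphic_on ball 0 \<delta>" "z \<in> ball 0 \<delta> \<Longrightarrow> cmod (H n z) \<le> 2"
    "z \<in> ball 0 s \<Longrightarrow> cmod (H n z) < 1 / real (Suc n)" and \<zeta>: "\<zeta> n \<in> cball 0 (2 * s)" "\<eta> \<le> cmod (H n (\<zeta> n))" for n z
    using p by (simp_all add: H_def \<zeta>_def)
  obtain g r where g: "g holomorphic_on ball 0 \<delta>" and r: "strict_mono (r :: nat \<Rightarrow> nat)"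
    and lim: "\<And>x. x \<in> ball 0 \<delta> \<Longrightarrow> ((\<lambda>n. H (r n) x) \<longlongrightarrow> g x) sequentially"
    and unif: "\<And>K. compact K \<Longrightarrow> K \<subseteq> ball 0 \<delta> \<Longrightarrow> uniform_limit K (H \<circ> r) g sequentially"
    by (rule Montel[of "ball 0 \<delta>" "range H" H]) (use H(1,2) in \<open>blast | simp\<close>)+
  have small: "g z = 0" if z: "z \<in> ball 0 s" for z
  proof -
    have "(\<lambda>n. H n z) \<longlonglongrightarrow> 0"
    proof (rule Lim_null_comparison[OF _ LIMSEQ_inverse_real_of_nat])
      show "\<forall>\<^sub>F n in sequentially. norm (H n z) \<le> inverse (real (Suc n))"
        using H(3)[OF z] by (intro always_eventually allI less_imp_le) (simp add: inverse_eq_divide)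
    qed
    then have "(\<lambda>n. H (r n) z) \<longlonglongrightarrow> 0"
      using LIMSEQ_subseq_LIMSEQ[OF _ r] by (simp add: o_def)
    then show ?thesis using lim[of z] z s by (intro LIMSEQ_unique[of "\<lambda>n. H (r n) z"]) auto
  qed
  have zero: "g z = 0" if z: "z \<in> ball 0 \<delta>" for z
  proof (rule analytic_continuation_open[of "ball 0 s" "ball 0 \<delta>" g "\<lambda>_. 0"])
    show "ball 0 s \<noteq> ({} :: complex set)" "ball 0 s \<subseteq> (ball 0 \<delta> :: complex set)" using s by auto
  qed (use small z g in auto)
  have "uniform_limit (cball 0 (2 * s)) (H \<circ> r) g sequentially"
    using s by (intro unif) auto
  then have "\<forall>\<^sub>F n in sequentially. \<forall>z\<in>cball 0 (2 * s). dist ((H \<circ> r) n z) (g z) < \<eta>"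
    using \<eta> by (rule uniform_limitD)
  then obtain n where n: "\<forall>z\<in>cball 0 (2 * s). dist (H (r n) z) (g z) < \<eta>"
    by (auto simp: eventually_sequentially)
  have "\<zeta> (r n) \<in> ball 0 \<delta>" using \<zeta>(1)[of "r n"] s by simp
  then have "cmod (H (r n) (\<zeta> (r n))) < \<eta>" using bspec[OF n \<zeta>(1)[of "r n"]] zero by (simp add: dist_norm)
  then show False using \<zeta>(2)[of "r n"] by simp
qed

text \<open>Once |v| \<le> 2 is known, the denominator sqrt (1 + |v|^2) is at most 3, and spherical
  distance to 0 becomes comparable to the modulus.\<close>

lemma rhoS_zero_bounds:
  assumes "rhoS y (Some 0) < 1/2"
  shows "\<exists>v. y = Some v \<and> cmod v \<le> 1 \<and> 2 * cmod v \<le> 3 * rhoS y (Some 0)"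
proof -
  obtain v where v: "y = Some v" "cmod v \<le> 2"
    using rhoS_near_bounded[of 0 y] assms by (auto simp: rhoS_commute)
  have "sqrt (1 + (cmod v)\<^sup>2) \<le> sqrt (3\<^sup>2)"
    using power_mono[OF v(2), of 2] by (intro real_sqrt_le_mono) simp
  then have le: "sqrt (1 + (cmod v)\<^sup>2) \<le> 3" by simp
  have pos: "sqrt (1 + (cmod v)\<^sup>2) > 0" by (simp add: add_pos_nonneg)
  have r: "rhoS y (Some 0) = 2 * cmod v / sqrt (1 + (cmod v)\<^sup>2)" by (simp add: v)
  have "2 * cmod v = rhoS y (Some 0) * sqrt (1 + (cmod v)\<^sup>2)" using pos by (simp add: r)
  also have "\<dots> \<le> rhoS y (Some 0) * 3" using le pos by (intro mult_left_mono) (auto simp: r)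
  finally have "2 * cmod v \<le> 3 * rhoS y (Some 0)" by simp
  then show ?thesis using assms v by auto
qed

lemma small_propagates:
  assumes f: "meromorphic_C f" and s: "0 < s" "2 * s < \<delta>"
    and \<delta>: "\<forall>w z. dist w z < \<delta> \<longrightarrow> norm_le 1 (f w) \<longrightarrow> norm_le 2 (f z)" and \<eta>: "\<eta> > 0"
  shows "\<exists>\<epsilon>>0. \<forall>x. (\<forall>z\<in>ball x s. rhoS (f z) (Some 0) < \<epsilon>) \<longrightarrow> (\<forall>z\<in>ball x (2 * s). rhoS (f z) (Some 0) < \<eta>)"
proof -
  have "\<eta> / 2 > 0" using \<eta> by simp
  from holomorphic_small_propagates[OF s this] obtain \<epsilon>0 where \<epsilon>0: "\<epsilon>0 > 0"
    "\<And>x F z. F holomorphic_on ball x \<delta> \<Longrightarrow> (\<And>z. z \<in> ball x \<delta> \<Longrightarrow> cmod (F z) \<le> 2) \<Longrightarrow>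
    (\<And>z. z \<in> ball x s \<Longrightarrow> cmod (F z) < \<epsilon>0) \<Longrightarrow> z \<in> ball x (2 * s) \<Longrightarrow> cmod (F z) < \<eta> / 2" by blast
  show ?thesis
  \<comment> \<open>Distance below 1/2 gives finite values of modulus at most 1, and below
    \<epsilon>0/2 a modulus of at most 3/4 \<epsilon>0. On the way back \<open>rhoS\<close> is at
    most twice the modulus, hence the target \<eta>/2 above.\<close>
  proof (intro exI[of _ "min (1/2) (\<epsilon>0 / 2)"] conjI allI impI ballI)
    show "0 < min (1/2) (\<epsilon>0 / 2)" using \<epsilon>0 by simp
    fix x z assume small: "\<forall>z\<in>ball x s. rhoS (f z) (Some 0) < min (1/2) (\<epsilon>0 / 2)" and z: "z \<in> ball x (2 * s)"
    have "norm_le 1 (f x)"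
      using rhoS_zero_bounds[of "f x"] small s by (auto simp: norm_le_def)
    then have le2: "norm_le 2 (f y)" if "y \<in> ball x \<delta>" for y using \<delta> that by auto
    have "cmod (cval (f z)) < \<eta> / 2"
    proof (rule \<epsilon>0(2)[of "\<lambda>z. cval (f z)"])
      show "(\<lambda>z. cval (f z)) holomorphic_on ball x \<delta>"
        using le2 by (intro meromorphic_C_holomorphic_on[OF f]) (auto simp: norm_le_def)
      show "cmod (cval (f y)) \<le> 2" if "y \<in> ball x \<delta>" for y using le2[OF that] by (auto simp: norm_le_def)
      show "cmod (cval (f y)) < \<epsilon>0" if "y \<in> ball x s" for y
      proof -
        have "rhoS (f y) (Some 0) < 1/2" "rhoS (f y) (Some 0) < \<epsilon>0 / 2" using small that by auto
        then show ?thesis using rhoS_zero_bounds[of "f y"] \<epsilon>0(1) by auto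
      qed
    qed (rule z)
    moreover obtain v where "f z = Some v"
      using le2[of z] z s by (auto simp: norm_le_def)
    ultimately show "rhoS (f z) (Some 0) < \<eta>"
      using rhoS_Some_le[of v 0] by simp
  qed
qed

text \<open>Each further doubling step, applied at shifted centres, widens the controlled radius by
  s. The thresholds are chosen backwards from \<eta>.\<close>

lemma small_propagates_far:
  assumes s: "0 < s"
    and step: "\<And>\<eta>::real. \<eta> > 0 \<Longrightarrow> \<exists>\<epsilon>>0. \<forall>x. (\<forall>z\<in>ball x s. P z < \<epsilon>) \<longrightarrow> (\<forall>z\<in>ball x (2 * s). P z < \<eta>)"
    and \<eta>: "\<eta> > 0"
  shows "\<exists>\<epsilon>>0. \<forall>x::complex. (\<forall>z\<in>ball x s. P z < \<epsilon>) \<longrightarrow> (\<forall>z\<in>ball x (s + real k * s). P z < \<eta>)"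
  using \<eta>
proof (induction k arbitrary: \<eta>)
  case 0
  then show ?case by auto
next
  case (Suc k)
  obtain \<epsilon>1 where \<epsilon>1: "\<epsilon>1 > 0" "\<And>x. \<forall>z\<in>ball x s. P z < \<epsilon>1 \<Longrightarrow> \<forall>z\<in>ball x (2 * s). P z < \<eta>"
    using step[OF Suc.prems] by blast
  obtain \<epsilon> where \<epsilon>: "\<epsilon> > 0" "\<And>x. \<forall>z\<in>ball x s. P z < \<epsilon> \<Longrightarrow> \<forall>z\<in>ball x (s + real k * s). P z < \<epsilon>1"
    using Suc.IH[OF \<epsilon>1(1)] by blast
  show ?case
  proof (intro exI[of _ \<epsilon>] conjI allI impI ballI)
    show "\<epsilon> > 0" by fact
    fix x z assume small: "\<forall>z\<in>ball x s. P z < \<epsilon>" and z: "z \<in> ball x (s + real (Suc k) * s)"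
    \<comment> \<open>As |z - x| < (k + 2) s, the point y divides the segment from x to z in the
      ratio k : 2. It is within k s of x, so its s-disc is already controlled, and z is within 2s of
      it.\<close>
    define t where "t = real k / (real k + 2)"
    define y where "y = x + of_real t * (z - x)"
    have t: "0 \<le> t" "1 - t = 2 / (real k + 2)" by (simp_all add: t_def field_simps)
    have d: "cmod (z - x) < (real k + 2) * s"
      using z by (simp add: dist_norm norm_minus_commute algebra_simps)
    have "cmod (y - x) = t * cmod (z - x)"
      using t(1) by (simp add: y_def norm_mult)
    also have "\<dots> \<le> t * ((real k + 2) * s)"
      using d t(1) by (intro mult_left_mono) auto
    finally have yx: "cmod (y - x) \<le> real k * s" by (simp add: t_def)
    have "z - y = of_real (1 - t) * (z - x)"
      by (simp add: y_def algebra_simps)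
    then have "cmod (z - y) = 2 / (real k + 2) * cmod (z - x)"
      unfolding t(2) by (simp only: norm_mult norm_of_real) simp
    also have "\<dots> < 2 / (real k + 2) * ((real k + 2) * s)"
      using d by (intro mult_strict_left_mono) auto
    finally have zy: "cmod (z - y) < 2 * s" by simp
    have "P v < \<epsilon>1" if "v \<in> ball y s" for v
    proof -
      have "dist x v < s + real k * s"
        using dist_triangle[of x v y] that yx by (simp add: dist_norm norm_minus_commute)
      then show ?thesis using \<epsilon>(2)[OF small] by simp
    qed
    then show "P z < \<eta>" using \<epsilon>1(2)[of y] zy by (simp add: dist_norm norm_minus_commute)
  qed
qed

text \<open>Closeness to 0 on an s-disc would spread by propagation to a disc containing the closed
  one of radius k about the same centre, against
  \<open>class_N1_not_uniformly_small\<close>.\<close>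

lemma class_N1_lower_bound:
  assumes f: "class_N1 f" and s: "0 < s" "2 * s < \<delta>"
    and \<delta>: "\<forall>w z. dist w z < \<delta> \<longrightarrow> norm_le 1 (f w) \<longrightarrow> norm_le 2 (f z)"
  shows "\<exists>\<epsilon>>0. \<forall>w. \<exists>z\<in>ball w s. \<epsilon> \<le> rhoS (f z) (Some 0)"
proof -
  have mer: "meromorphic_C f" using f by (simp add: class_N1_def)
  obtain k :: nat where k: "\<And>w. \<exists>z\<in>cball w (real k). 1 / real (Suc k) \<le> rhoS (f z) (Some 0)"
    using class_N1_not_uniformly_small[OF f] by blast
  obtain n :: nat where n: "real k / s < real n" using reals_Archimedean2 by blast
  then have kn: "real k < s + real n * s" using s by (simp add: field_simps)
  have "1 / real (Suc k) > 0" by simp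
  note far = small_propagates_far[OF s(1) small_propagates[OF mer s \<delta>] this, where k = n]
  from far
  obtain \<epsilon> where \<epsilon>: "\<epsilon> > 0" "\<And>x. \<forall>z\<in>ball x s. rhoS (f z) (Some 0) < \<epsilon> \<Longrightarrow>
      \<forall>z\<in>ball x (s + real n * s). rhoS (f z) (Some 0) < 1 / real (Suc k)" by blast
  have "\<exists>z\<in>ball w s. \<epsilon> \<le> rhoS (f z) (Some 0)" for w
  proof (rule ccontr)
    assume "\<not> ?thesis"
    then have "\<forall>z\<in>ball w s. rhoS (f z) (Some 0) < \<epsilon>" by (simp add: not_le)
    then have small: "\<forall>z\<in>ball w (s + real n * s). rhoS (f z) (Some 0) < 1 / real (Suc k)" by (rule \<epsilon>(2))
    obtain z where "z \<in> cball w (real k)" "1 / real (Suc k) \<le> rhoS (f z) (Some 0)" using k by blast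
    moreover from this kn have "z \<in> ball w (s + real n * s)" by simp
    ultimately show False using small by fastforce
  qed
  then show ?thesis using \<epsilon>(1) by blast
qed

section \<open>Local bounds for log|f| by logarithmic singularities\<close>

text \<open>The lower bound holds at some z0 near w rather than at w, so the disc is recentred. As
  |w - z0| < \<delta>/32, the disc of radius \<delta>/2 about z0 stays in
  \<open>ball w \<delta>\<close>, where |f| \<le> 2, and \<open>ball w (\<delta> / 32)\<close> lies
  in the disc of radius \<delta>/16 about z0, an eighth of \<delta>/2.\<close>

lemma class_N1_local_ln_bound_finite:
  assumes f: "class_N1 f" and \<delta>01: "0 < \<delta>" "\<delta> \<le> 1"
    and \<delta>: "\<forall>w z. dist w z < \<delta> \<longrightarrow> norm_le 1 (f w) \<longrightarrow> norm_le 2 (f z)"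
  shows "\<exists>N B. \<forall>w. norm_le 1 (f w) \<longrightarrow> (\<exists>as. length as \<le> N \<and> (\<forall>z\<in>ball w (\<delta> / 32). cval (f z) \<noteq> 0 \<longrightarrow>
        (\<forall>a\<in>set as. z \<noteq> a) \<and>
        \<bar>ln (cmod (cval (f z)))\<bar> \<le> B - sum_list (map (\<lambda>a. ln (cmod (z - a))) as)))"
proof -
  have mer: "meromorphic_C f" using f by (simp add: class_N1_def)
  obtain \<epsilon> where \<epsilon>: "\<epsilon> > 0" "\<And>w. \<exists>z\<in>ball w (\<delta> / 32). \<epsilon> \<le> rhoS (f z) (Some 0)"
  proof -
    have "0 < \<delta> / 32" "2 * (\<delta> / 32) < \<delta>" using \<delta>01 by auto
    from class_N1_lower_bound[OF f this \<delta>] show ?thesis using that by blast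
  qed
  obtain N B where NB: "\<And>F z0. F holomorphic_on ball z0 (\<delta> / 2) \<Longrightarrow> (\<forall>z\<in>ball z0 (\<delta> / 2). cmod (F z) \<le> 2) \<Longrightarrow> \<epsilon> / 2 \<le> cmod (F z0) \<Longrightarrow>
     \<exists>as. length as \<le> N \<and> (\<forall>z\<in>ball z0 (\<delta> / 2 / 8). F z \<noteq> 0 \<longrightarrow>
        (\<forall>a\<in>set as. 0 < cmod (z - a) \<and> cmod (z - a) \<le> 1) \<and>
        \<bar>ln (cmod (F z))\<bar> \<le> B - sum_list (map (\<lambda>a. ln (cmod (z - a))) as))"
  proof -
    have "0 < \<delta> / 2" "\<delta> / 2 \<le> 1" "0 < \<epsilon> / 2" using \<delta>01 \<epsilon>(1) by auto
    from bounded_holomorphic_ln_bound[OF this] show ?thesis using that by blast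
  qed
  show ?thesis
  proof (intro exI[of _ N] exI[of _ B] allI impI)
    fix w assume w: "norm_le 1 (f w)"
    obtain z0 where z0: "dist w z0 < \<delta> / 32" "\<epsilon> \<le> rhoS (f z0) (Some 0)" using \<epsilon>(2)[of w] by auto
    have sub: "ball z0 (\<delta> / 2) \<subseteq> ball w \<delta>"
    proof
      fix z assume "z \<in> ball z0 (\<delta> / 2)"
      then show "z \<in> ball w \<delta>" using dist_triangle[of w z z0] z0(1) \<delta>01 by simp
    qed
    have sub2: "z \<in> ball z0 (\<delta> / 2 / 8)" if "z \<in> ball w (\<delta> / 32)" for z
      using dist_triangle[of z0 z w] that z0(1) by (simp add: dist_commute)
    have le2: "norm_le 2 (f z)" if "z \<in> ball w \<delta>" for z using \<delta> that w by auto
    obtain v where v: "f z0 = Some v" using le2[of z0] z0(1) \<delta>01 by (auto simp: norm_le_def)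
    have "\<exists>as. length as \<le> N \<and> (\<forall>z\<in>ball z0 (\<delta> / 2 / 8). cval (f z) \<noteq> 0 \<longrightarrow>
        (\<forall>a\<in>set as. 0 < cmod (z - a) \<and> cmod (z - a) \<le> 1) \<and>
        \<bar>ln (cmod (cval (f z)))\<bar> \<le> B - sum_list (map (\<lambda>a. ln (cmod (z - a))) as))"
    proof (rule NB)
      show "(\<lambda>z. cval (f z)) holomorphic_on ball z0 (\<delta> / 2)"
        using le2 sub by (intro meromorphic_C_holomorphic_on[OF mer]) (auto simp: norm_le_def subset_iff)
      show "\<forall>z\<in>ball z0 (\<delta> / 2). cmod (cval (f z)) \<le> 2"
      proof
        fix z assume "z \<in> ball z0 (\<delta> / 2)"
        then have "norm_le 2 (f z)" using le2 sub by blast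
        then show "cmod (cval (f z)) \<le> 2" by (auto simp: norm_le_def)
      qed
      show "\<epsilon> / 2 \<le> cmod (cval (f z0))" using z0(2) rhoS_Some_le[of v 0] by (simp add: v)
    qed
    then obtain as where as: "length as \<le> N" "\<And>z. z \<in> ball z0 (\<delta> / 2 / 8) \<Longrightarrow> cval (f z) \<noteq> 0 \<Longrightarrow>
        (\<forall>a\<in>set as. 0 < cmod (z - a) \<and> cmod (z - a) \<le> 1) \<and>
        \<bar>ln (cmod (cval (f z)))\<bar> \<le> B - sum_list (map (\<lambda>a. ln (cmod (z - a))) as)" by blast
    show "\<exists>as. length as \<le> N \<and> (\<forall>z\<in>ball w (\<delta> / 32). cval (f z) \<noteq> 0 \<longrightarrow>
        (\<forall>a\<in>set as. z \<noteq> a) \<and>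
        \<bar>ln (cmod (cval (f z)))\<bar> \<le> B - sum_list (map (\<lambda>a. ln (cmod (z - a))) as))"
    proof (intro exI[of _ as] conjI ballI impI)
      show "length as \<le> N" by (rule as(1))
      fix z assume z: "z \<in> ball w (\<delta> / 32)" "cval (f z) \<noteq> 0"
      note z' = as(2)[OF sub2[OF z(1)] z(2)]
      show "z \<noteq> a" if "a \<in> set as" for a using z' that by auto
      show "\<bar>ln (cmod (cval (f z)))\<bar> \<le> B - sum_list (map (\<lambda>a. ln (cmod (z - a))) as)" using z' by blast
    qed
  qed
qed

text \<open>At every w either |f| \<le> 1 or |1/f| \<le> 1, and the preceding bound applies to f or
  to its inversion. Inversion only changes the sign of the logarithm, so both cases bound the same
  quantity.\<close>

lemma class_N1_local_ln_bound:
  assumes f: "class_N1 f"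
  shows "\<exists>s>0. \<exists>B\<ge>0. \<exists>N. \<forall>w. \<exists>as. length as \<le> N \<and> (\<forall>z\<in>ball w s. z \<notin> {z. cval (f z) = 0} \<longrightarrow>
        (\<forall>a\<in>set as. z \<noteq> a) \<and>
        \<bar>ln (cmod (cval (f z)))\<bar> \<le> B - sum_list (map (\<lambda>a. ln (cmod (z - a))) as))"
proof -
  have mer: "meromorphic_C f" and nor: "normal_fn f" using f by (simp_all add: class_N1_def)
  obtain \<delta>0 where \<delta>0: "\<delta>0 > 0" "\<And>w z. dist w z < \<delta>0 \<Longrightarrow> (norm_le 1 (f w) \<longrightarrow> norm_le 2 (f z)) \<and>
    (norm_le 1 (sinv (f w)) \<longrightarrow> norm_le 2 (sinv (f z)))"
    using normal_fn_norm_le[OF mer nor] by blast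
  define \<delta> where "\<delta> = min \<delta>0 1"
  have \<delta>: "0 < \<delta>" "\<delta> \<le> 1" using \<delta>0 by (auto simp: \<delta>_def)
  have d1: "\<forall>w z. dist w z < \<delta> \<longrightarrow> norm_le 1 (f w) \<longrightarrow> norm_le 2 (f z)"
    and d2: "\<forall>w z. dist w z < \<delta> \<longrightarrow> norm_le 1 (sinv (f w)) \<longrightarrow> norm_le 2 (sinv (f z))"
    using \<delta>0(2) by (auto simp: \<delta>_def)
  let ?L = "\<lambda>f N B w. \<exists>as. length as \<le> N \<and> (\<forall>z\<in>ball w (\<delta> / 32). cval (f z) \<noteq> 0 \<longrightarrow>
        (\<forall>a\<in>set as. z \<noteq> a) \<and>
        \<bar>ln (cmod (cval (f z)))\<bar> \<le> B - sum_list (map (\<lambda>a. ln (cmod (z - a))) as))"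
  obtain N1 B1 where 1: "\<And>w. norm_le 1 (f w) \<Longrightarrow> ?L f N1 B1 w"
    using class_N1_local_ln_bound_finite[OF f \<delta> d1] by blast
  obtain N2 B2 where "\<And>w. norm_le 1 (sinv (f w)) \<Longrightarrow> ?L (\<lambda>z. sinv (f z)) N2 B2 w"
    using class_N1_local_ln_bound_finite[OF class_N1_sinv[OF f] \<delta> d2] by blast
  then have 2: "\<And>w. norm_le 1 (sinv (f w)) \<Longrightarrow> ?L f N2 B2 w"
    by (simp add: cval_sinv norm_inverse ln_inverse)
  have mono: "?L f (max N1 N2) (max 0 (max B1 B2)) w" if L: "?L f N B w" and N: "N \<le> max N1 N2" and B: "B \<le> max 0 (max B1 B2)" for w N B
  proof -
    obtain as where as: "length as \<le> N" "\<And>z. z\<in>ball w (\<delta> / 32) \<Longrightarrow> cval (f z) \<noteq> 0 \<Longrightarrow>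
        (\<forall>a\<in>set as. z \<noteq> a) \<and>
        \<bar>ln (cmod (cval (f z)))\<bar> \<le> B - sum_list (map (\<lambda>a. ln (cmod (z - a))) as)"
      using L by blast
    show ?thesis
    proof (intro exI[of _ as] conjI ballI impI)
      show "length as \<le> max N1 N2" using as(1) N by linarith
      fix z assume z: "z \<in> ball w (\<delta> / 32)" "cval (f z) \<noteq> 0"
      show "z \<noteq> a" if "a \<in> set as" for a using as(2)[OF z] that by blast
      show "\<bar>ln (cmod (cval (f z)))\<bar> \<le> max 0 (max B1 B2) - sum_list (map (\<lambda>a. ln (cmod (z - a))) as)"
        using as(2)[OF z] B by linarith
    qed
  qed
  have "?L f (max N1 N2) (max 0 (max B1 B2)) w" for w
    using norm_le_one_cases[of "f w"]
  proof
    assume "norm_le 1 (f w)"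
    from mono[OF 1[OF this]] show ?thesis by simp
  next
    assume "norm_le 1 (sinv (f w))"
    from mono[OF 2[OF this]] show ?thesis by simp
  qed
  then show ?thesis
    using \<delta>(1) by (intro exI[of _ "\<delta> / 32"] conjI exI[of _ "max 0 (max B1 B2)"] exI[of _ "max N1 N2"]) simp_all
qed

subsection \<open>Integrals of the counting functions\<close>

lemma has_real_derivative_ln_max:
  assumes "t > 0" "t \<noteq> \<beta>"
  shows "((\<lambda>t. ln (max t \<beta>)) has_real_derivative (if \<beta> < t then 1 / t else 0)) (at t)"
proof (cases "\<beta> < t")
  case True
  have "(ln has_real_derivative 1 / t) (at t)"
    using assms(1) by (auto intro!: derivative_eq_intros)
  then have "((\<lambda>t. ln (max t \<beta>)) has_real_derivative 1 / t) (at t)"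
    by (rule has_field_derivative_transform_within_open[of _ _ _ "{\<beta><..}"]) (use True in \<open>auto simp: max_def\<close>)
  then show ?thesis using True by simp
next
  case False
  have "((\<lambda>t. ln \<beta>) has_real_derivative 0) (at t)" by simp
  then have "((\<lambda>t. ln (max t \<beta>)) has_real_derivative 0) (at t)"
    by (rule has_field_derivative_transform_within_open[of _ _ _ "{..<\<beta>}"]) (use False assms in \<open>auto simp: max_def\<close>)
  then show ?thesis using False by simp
qed

lemma has_real_derivative_square_div_max:
  assumes "t > 0" "t \<noteq> \<beta>"
  shows "((\<lambda>t. t\<^sup>2 / (2 * (max t \<beta>)\<^sup>2)) has_real_derivative (if \<beta> < t then 0 else t / \<beta>\<^sup>2)) (at t)"
proof (cases "\<beta> < t")
  case True
  have "((\<lambda>t. 1 / 2 :: real) has_real_derivative 0) (at t)" by simp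
  then have "((\<lambda>t. t\<^sup>2 / (2 * (max t \<beta>)\<^sup>2)) has_real_derivative 0) (at t)"
    by (rule has_field_derivative_transform_within_open[of _ _ _ "{max \<beta> 0<..}"])
       (use True assms in \<open>auto simp: max_def split: if_splits\<close>)
  then show ?thesis using True by simp
next
  case False
  then have t: "t < \<beta>" using assms by simp
  have "((\<lambda>t. t\<^sup>2 / (2 * \<beta>\<^sup>2)) has_real_derivative t / \<beta>\<^sup>2) (at t)"
    using t assms by (auto intro!: derivative_eq_intros simp: field_simps)
  then have "((\<lambda>t. t\<^sup>2 / (2 * (max t \<beta>)\<^sup>2)) has_real_derivative t / \<beta>\<^sup>2) (at t)"
    by (rule has_field_derivative_transform_within_open[of _ _ _ "{..<\<beta>}"]) (use t in \<open>auto simp: max_def\<close>)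
  then show ?thesis using False by simp
qed

lemma integral_inverse_indicator:
  fixes r \<beta> :: real
  assumes r: "1 \<le> r"
  shows "((\<lambda>t. if \<beta> < t then 1 / t else 0) has_integral (ln (max r \<beta>) - ln (max 1 \<beta>))) {1..r}"
proof (rule fundamental_theorem_of_calculus_strong[of "{\<beta>}"])
  show "continuous_on {1..r} (\<lambda>t. ln (max t \<beta>))" by (intro continuous_intros) auto
  show "((\<lambda>t. ln (max t \<beta>)) has_vector_derivative (if \<beta> < t then 1 / t else 0)) (at t)" if "t \<in> {1..r} - {\<beta>}" for t
    using has_real_derivative_ln_max[of t \<beta>] that by (simp add: has_real_derivative_iff_has_vector_derivative)
qed (use r in auto)

text \<open>The integrand is t/\<beta>^2 below \<beta> and 1/t above. The sum of the two partial
  primitives is continuous across \<beta>, and its logarithmic part is the primitive of the counting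
  kernel in \<open>integral_inverse_indicator\<close>.\<close>

lemma integral_div_max_square:
  fixes r \<beta> :: real
  assumes r: "1 \<le> r"
  shows "((\<lambda>t. t / (max t \<beta>)\<^sup>2) has_integral
     ((ln (max r \<beta>) + r\<^sup>2 / (2 * (max r \<beta>)\<^sup>2)) - (ln (max 1 \<beta>) + 1 / (2 * (max 1 \<beta>)\<^sup>2)))) {1..r}"
proof -
  have "((\<lambda>t. t / (max t \<beta>)\<^sup>2) has_integral
     ((ln (max r \<beta>) + r\<^sup>2 / (2 * (max r \<beta>)\<^sup>2)) - (ln (max 1 \<beta>) + 1\<^sup>2 / (2 * (max 1 \<beta>)\<^sup>2)))) {1..r}"
  proof (rule fundamental_theorem_of_calculus_strong[of "{\<beta>}"])
    show "continuous_on {1..r} (\<lambda>t. ln (max t \<beta>) + t\<^sup>2 / (2 * (max t \<beta>)\<^sup>2))"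
      by (intro continuous_intros) (auto simp: max_def)
    fix t assume t: "t \<in> {1..r} - {\<beta>}"
    have eq: "(if \<beta> < t then 1 / t else 0) + (if \<beta> < t then 0 else t / \<beta>\<^sup>2) = t / (max t \<beta>)\<^sup>2"
      using t by (auto simp: max_def power2_eq_square)
    have "((\<lambda>t. ln (max t \<beta>) + t\<^sup>2 / (2 * (max t \<beta>)\<^sup>2)) has_real_derivative
        (if \<beta> < t then 1 / t else 0) + (if \<beta> < t then 0 else t / \<beta>\<^sup>2)) (at t)"
      using t by (intro DERIV_add has_real_derivative_ln_max has_real_derivative_square_div_max) auto
    then show "((\<lambda>t. ln (max t \<beta>) + t\<^sup>2 / (2 * (max t \<beta>)\<^sup>2)) has_vector_derivative t / (max t \<beta>)\<^sup>2) (at t)"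
      by (simp only: eq has_real_derivative_iff_has_vector_derivative)
  qed (use r in auto)
  then show ?thesis by simp
qed

text \<open>The index set no longer depends on t, which enters only through an indicator; the sum
  can then be integrated term by term.\<close>

lemma count_eq_sum:
  fixes c :: complex and t R :: real
  assumes f: "meromorphic_C f" and t: "t \<le> R"
  defines "A \<equiv> {a \<in> cball c R. mord f a \<noteq> 0}"
  shows "zero_count f c t - pole_count f c t = (\<Sum>a\<in>A. if cmod (a - c) < t then of_int (mord f a) else 0)"
    and "zero_sum f c t - pole_sum f c t = (\<Sum>a\<in>A. if cmod (a - c) < t then of_int (mord f a) * (a - c) else 0)"
proof -
  have fin: "finite A" unfolding A_def by (rule finite_divisor[OF f])
  have Z: "{z. cmod (z - c) < t \<and> f z = Some 0} = {a\<in>A. cmod (a - c) < t \<and> mord f a > 0}"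
    using t mord_sign(2)[OF f] by (auto simp: A_def dist_norm norm_minus_commute)
  have P: "{z. cmod (z - c) < t \<and> f z = None} = {a\<in>A. cmod (a - c) < t \<and> mord f a < 0}"
    using t mord_sign(1)[OF f] by (auto simp: A_def dist_norm norm_minus_commute)
  have z: "zero_count f c t = (\<Sum>a\<in>A. if cmod (a - c) < t \<and> mord f a > 0 then real (nat (mord f a)) else 0)"
    unfolding zero_count_def Z of_nat_sum by (rule sum.inter_filter[OF fin])
  have p: "pole_count f c t = (\<Sum>a\<in>A. if cmod (a - c) < t \<and> mord f a < 0 then real (nat (- mord f a)) else 0)"
    unfolding pole_count_def P of_nat_sum by (rule sum.inter_filter[OF fin])
  show "zero_count f c t - pole_count f c t = (\<Sum>a\<in>A. if cmod (a - c) < t then of_int (mord f a) else 0)"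
    unfolding z p sum_subtractf[symmetric] by (intro sum.cong) auto
  have z: "zero_sum f c t = (\<Sum>a\<in>A. if cmod (a - c) < t \<and> mord f a > 0 then of_nat (nat (mord f a)) * (a - c) else 0)"
    unfolding zero_sum_def Z by (rule sum.inter_filter[OF fin])
  have p: "pole_sum f c t = (\<Sum>a\<in>A. if cmod (a - c) < t \<and> mord f a < 0 then of_nat (nat (- mord f a)) * (a - c) else 0)"
    unfolding pole_sum_def P by (rule sum.inter_filter[OF fin])
  show "zero_sum f c t - pole_sum f c t = (\<Sum>a\<in>A. if cmod (a - c) < t then of_int (mord f a) * (a - c) else 0)"
    unfolding z p sum_subtractf[symmetric] by (intro sum.cong) auto
qed

section \<open>Uniform bounds for circle means and moments\<close>

text \<open>This transfers bounds to the finitely many radii whose circle meets the divisor. The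
  limit is taken from the right, so that radii above t suffice, also at t = 1.\<close>

lemma norm_le_of_cofinite:
  fixes F :: "real \<Rightarrow> 'b::real_normed_vector"
  assumes cont: "isCont F t" and T: "finite T" and t: "t < R"
    and le: "\<And>s. t < s \<Longrightarrow> s < R \<Longrightarrow> s \<notin> T \<Longrightarrow> norm (F s) \<le> D"
  shows "norm (F t) \<le> D"
proof (rule tendsto_upperbound)
  show "((\<lambda>s. norm (F s)) \<longlongrightarrow> norm (F t)) (at_right t)"
    using cont by (intro tendsto_norm) (auto simp: isCont_def intro: filterlim_mono[OF _ order_refl at_le])
  have "\<forall>\<^sub>F s in at t. s \<notin> T"
    using islimpt_finite[OF T, of t] by (simp add: islimpt_iff_eventually)
  then have "\<forall>\<^sub>F s in at_right t. s \<notin> T"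
    by (rule filter_leD[OF at_le, rotated]) simp
  moreover have "\<forall>\<^sub>F s in at_right t. s \<in> {t<..<R}"
    using t by (rule eventually_at_right_real)
  ultimately show "\<forall>\<^sub>F s in at_right t. norm (F s) \<le> D"
    by eventually_elim (use le in auto)
qed simp

text \<open>The order of quantifiers matters: D is uniform in c and R, whereas p and q come from the
  zero-free factor on the particular disc.\<close>

lemma class_N1_circle_means_bounded:
  assumes N1: "class_N1 f"
  shows "\<exists>D. \<forall>c R. \<exists>p q. \<forall>t. 1 \<le> t \<longrightarrow> t < R \<longrightarrow>
     \<bar>(\<Sum>a\<in>{a \<in> cball c R. mord f a \<noteq> 0}. of_int (mord f a) * ln (max t (cmod (a - c)))) + p\<bar> \<le> D \<and>
     cmod (of_real t * q - (\<Sum>a\<in>{a \<in> cball c R. mord f a \<noteq> 0}.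
        of_int (mord f a) * ((a - c) * of_real (t / (max t (cmod (a - c)))\<^sup>2)))) \<le> D"
proof -
  have f: "meromorphic_C f" using N1 by (simp add: class_N1_def)
  let ?Z = "{z. cval (f z) = 0}"
  obtain s B N where s: "s > 0" and B: "B \<ge> 0" and loc: "\<And>w. \<exists>as. length as \<le> N \<and> (\<forall>z\<in>ball w s. z \<notin> ?Z \<longrightarrow>
        (\<forall>a\<in>set as. z \<noteq> a) \<and>
        \<bar>ln (cmod (cval (f z)))\<bar> \<le> B - sum_list (map (\<lambda>a. ln (cmod (z - a))) as))"
    using class_N1_local_ln_bound[OF N1] by blast
  obtain C where C: "\<And>c t. 1 \<le> t \<Longrightarrow> \<forall>\<theta>. c + of_real t * cis \<theta> \<notin> ?Z \<Longrightarrow>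
     continuous_on UNIV (\<lambda>\<theta>. ln (cmod (cval (f (c + of_real t * cis \<theta>))))) \<Longrightarrow>
     integral {0..2*pi} (\<lambda>\<theta>. \<bar>ln (cmod (cval (f (c + of_real t * cis \<theta>))))\<bar>) \<le> C"
    using circle_integral_bound[OF s B loc] by blast
  show ?thesis
  \<comment> \<open>The moment carries the factor pi and the mean the factor 2 pi; the weaker of the
    two resulting bounds serves both.\<close>
  proof (rule exI[of _ "C / pi"], intro allI)
    fix c :: complex and R :: real
    define A where "A = {a \<in> cball c R. mord f a \<noteq> 0}"
    have fin: "finite A" unfolding A_def by (rule finite_divisor[OF f])
    obtain p q where J: "\<And>t. 0 < t \<Longrightarrow> t < R \<Longrightarrow> \<forall>a\<in>A. cmod (a - c) \<noteq> t \<Longrightarrow>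
     continuous_on UNIV (\<lambda>\<theta>. ln (cmod (cval (f (c + of_real t * cis \<theta>))))) \<and>
     ((\<lambda>\<theta>. ln (cmod (cval (f (c + of_real t * cis \<theta>))))) has_integral
        2 * pi * ((\<Sum>a\<in>A. of_int (mord f a) * ln (max t (cmod (a - c)))) + p)) {0..2*pi} \<and>
     ((\<lambda>\<theta>. of_real (ln (cmod (cval (f (c + of_real t * cis \<theta>))))) * cis \<theta>) has_integral
        of_real pi * (of_real t * q - (\<Sum>a\<in>A. of_int (mord f a) * ((a - c) * of_real (t / (max t (cmod (a - c)))\<^sup>2))))) {0..2*pi}"
      using Jensen_moments[OF f, of R c] unfolding A_def by blast
    define U where "U = (\<lambda>t. (\<Sum>a\<in>A. of_int (mord f a) * ln (max t (cmod (a - c)))) + p)"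
    define M where "M = (\<lambda>t. of_real t * q - (\<Sum>a\<in>A. of_int (mord f a) * ((a - c) * of_real (t / (max t (cmod (a - c)))\<^sup>2))))"
    define T where "T = (\<lambda>a. cmod (a - c)) ` A"
    have gen: "\<bar>U t\<bar> \<le> C / pi \<and> cmod (M t) \<le> C / pi" if t: "1 \<le> t" "t < R" "t \<notin> T" for t
    proof -
      let ?u = "\<lambda>\<theta>. ln (cmod (cval (f (c + of_real t * cis \<theta>))))"
      have "\<forall>a\<in>A. cmod (a - c) \<noteq> t" using t(3) by (auto simp: T_def)
      with J[of t] t have cont: "continuous_on UNIV ?u"
        and U: "(?u has_integral 2 * pi * U t) {0..2*pi}"
        and M: "((\<lambda>\<theta>. of_real (?u \<theta>) * cis \<theta>) has_integral of_real pi * M t) {0..2*pi}"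
        by (auto simp: U_def M_def)
      have "c + of_real t * cis \<theta> \<notin> ?Z" for \<theta>
      proof
        let ?z = "c + of_real t * cis \<theta>"
        assume "?z \<in> ?Z"
        then have "f ?z = None \<or> f ?z = Some 0" by (auto simp: cval_def split: option.splits)
        then have "mord f ?z \<noteq> 0" using mord_sign[OF f, of ?z] by auto
        moreover have "cmod (?z - c) = t" using t by (simp add: norm_mult)
        ultimately have "?z \<in> A" using t by (simp add: A_def dist_norm norm_mult)
        then have "t \<in> T" using \<open>cmod (?z - c) = t\<close> by (force simp: T_def)
        then show False using t by simp
      qed
      then have bound: "integral {0..2*pi} (\<lambda>\<theta>. \<bar>?u \<theta>\<bar>) \<le> C"
        using C[OF t(1) _ cont] by blast
      have int: "(\<lambda>\<theta>. \<bar>?u \<theta>\<bar>) integrable_on {0..2*pi}"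
        using cont by (intro integrable_continuous_interval continuous_on_rabs) (rule continuous_on_subset, auto)
      have "norm (integral {0..2*pi} ?u) \<le> integral {0..2*pi} (\<lambda>\<theta>. \<bar>?u \<theta>\<bar>)"
        using U int by (intro Henstock_Kurzweil_Integration.integral_norm_bound_integral) auto
      then have U1: "\<bar>2 * pi * U t\<bar> \<le> C" using bound integral_unique[OF U] by simp
      have "norm (integral {0..2*pi} (\<lambda>\<theta>. of_real (?u \<theta>) * cis \<theta>)) \<le> integral {0..2*pi} (\<lambda>\<theta>. \<bar>?u \<theta>\<bar>)"
        using M int by (intro Henstock_Kurzweil_Integration.integral_norm_bound_integral) (auto simp: norm_mult)
      then have M1: "cmod (of_real pi * M t) \<le> C" using bound integral_unique[OF M] by simp
      have "pi * \<bar>U t\<bar> \<le> 2 * (pi * \<bar>U t\<bar>)" by simp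
      also have "\<dots> = \<bar>2 * pi * U t\<bar>" by (simp add: abs_mult)
      finally have "pi * \<bar>U t\<bar> \<le> C" using U1 by linarith
      moreover have "pi * cmod (M t) \<le> C" using M1 by (simp add: norm_mult)
      ultimately show ?thesis by (simp add: pos_le_divide_eq mult.commute)
    qed
    have "\<bar>U t\<bar> \<le> C / pi \<and> cmod (M t) \<le> C / pi" if t: "1 \<le> t" "t < R" for t
    proof
      have mx: "max t b \<noteq> 0" for b using t by simp
      have "isCont (\<lambda>t. max t b) t" for b :: real by (intro continuous_intros)
      then have "isCont U t" "isCont M t"
        unfolding U_def M_def using mx by (intro continuous_intros; simp)+
      moreover have "finite T" using fin by (simp add: T_def)
      ultimately show "\<bar>U t\<bar> \<le> C / pi" "cmod (M t) \<le> C / pi"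
        using norm_le_of_cofinite[where F = U and t = t and T = T and R = R and D = "C / pi"]
          norm_le_of_cofinite[where F = M and t = t and T = T and R = R and D = "C / pi"] gen t by auto
    qed
    then show "\<exists>p q. \<forall>t. 1 \<le> t \<longrightarrow> t < R \<longrightarrow>
     \<bar>(\<Sum>a\<in>{a \<in> cball c R. mord f a \<noteq> 0}. of_int (mord f a) * ln (max t (cmod (a - c)))) + p\<bar> \<le> C / pi \<and>
     cmod (of_real t * q - (\<Sum>a\<in>{a \<in> cball c R. mord f a \<noteq> 0}.
        of_int (mord f a) * ((a - c) * of_real (t / (max t (cmod (a - c)))\<^sup>2)))) \<le> C / pi"
      unfolding A_def[symmetric] U_def M_def by blast
  qed
qed

theorem mainTheorem17:
  fixes f :: "complex \<Rightarrow> complex option"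
  assumes "class_N1 f"
  shows "\<exists>C::real. \<forall>c::complex. \<forall>r::real. r > 1 \<longrightarrow>
     \<bar>integral {1..r} (\<lambda>t. (zero_count f c t - pole_count f c t) / t)\<bar> < C \<and>
     cmod ((1 / of_real r) * integral {1..r} (\<lambda>t. (zero_sum f c t - pole_sum f c t) / of_real t)) < C"
proof -
  have f: "meromorphic_C f" using assms by (simp add: class_N1_def)
  obtain D where D: "\<And>c R. \<exists>p q. \<forall>t. 1 \<le> t \<longrightarrow> t < R \<longrightarrow>
     \<bar>(\<Sum>a\<in>{a \<in> cball c R. mord f a \<noteq> 0}. of_int (mord f a) * ln (max t (cmod (a - c)))) + p\<bar> \<le> D \<and>
     cmod (of_real t * q - (\<Sum>a\<in>{a \<in> cball c R. mord f a \<noteq> 0}.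
        of_int (mord f a) * ((a - c) * of_real (t / (max t (cmod (a - c)))\<^sup>2)))) \<le> D"
    using class_N1_circle_means_bounded[OF assms] by blast
  show ?thesis
  \<comment> \<open>Both quantities are at most 2 D; the summand 1 makes the inequalities
    strict.\<close>
  proof (intro exI[of _ "2 * D + 1"] allI impI)
    fix c :: complex and r :: real assume r: "r > 1"
    \<comment> \<open>The bounds for U and M hold at radii strictly below that of the disc, and they
      are needed at t = r.\<close>
    define A where "A = {a \<in> cball c (r + 1). mord f a \<noteq> 0}"
    obtain p q where pq: "\<And>t. 1 \<le> t \<Longrightarrow> t < r + 1 \<Longrightarrow>
       \<bar>(\<Sum>a\<in>A. of_int (mord f a) * ln (max t (cmod (a - c)))) + p\<bar> \<le> D \<and>
       cmod (of_real t * q - (\<Sum>a\<in>A. of_int (mord f a) * ((a - c) * of_real (t / (max t (cmod (a - c)))\<^sup>2)))) \<le> D"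
      using D[where c = c and R = "r + 1"] unfolding A_def by blast
    define U where "U = (\<lambda>t. (\<Sum>a\<in>A. of_int (mord f a) * ln (max t (cmod (a - c)))) + p)"
    define M where "M = (\<lambda>t. of_real t * q - (\<Sum>a\<in>A. of_int (mord f a) * ((a - c) * of_real (t / (max t (cmod (a - c)))\<^sup>2))))"
    \<comment> \<open>\<open>L\<close> is the integral of the counting kernel of one point. The
      kernel in M integrates to \<open>L + E\<close>, where \<open>E\<close> consists of endpoint
      values only.\<close>
    define L where "L = (\<lambda>a. ln (max r (cmod (a - c))) - ln (max 1 (cmod (a - c))))"
    define E where "E = (\<lambda>a. r\<^sup>2 / (2 * (max r (cmod (a - c)))\<^sup>2) - 1 / (2 * (max 1 (cmod (a - c)))\<^sup>2))"
    have bU: "\<bar>U t\<bar> \<le> D" and bM: "cmod (M t) \<le> D" if "1 \<le> t" "t \<le> r" for t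
      using pq[of t] that by (auto simp: U_def M_def)
    have D0: "0 \<le> D" using bU[of 1] r by linarith
    have fin: "finite A" unfolding A_def by (rule finite_divisor[OF f])
    have ind: "((\<lambda>t. if cmod (a - c) < t then 1 / t else 0) has_integral L a) {1..r}" for a
      unfolding L_def using r by (intro integral_inverse_indicator) simp
    have "((\<lambda>t. \<Sum>a\<in>A. of_int (mord f a) * (if cmod (a - c) < t then 1 / t else 0))
        has_integral (\<Sum>a\<in>A. of_int (mord f a) * L a)) {1..r}"
      by (intro has_integral_sum fin has_integral_mult_right ind)
    moreover have "(\<Sum>a\<in>A. of_int (mord f a) * (if cmod (a - c) < t then 1 / t else 0)) = (zero_count f c t - pole_count f c t) / t"
      if "t \<in> {1..r}" for t
      using that by (subst count_eq_sum(1)[OF f, of t "r + 1"]) (auto simp: A_def sum_divide_distrib intro!: sum.cong)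
    ultimately have "((\<lambda>t. (zero_count f c t - pole_count f c t) / t) has_integral (\<Sum>a\<in>A. of_int (mord f a) * L a)) {1..r}"
      by (rule has_integral_eq[rotated])
    then have "integral {1..r} (\<lambda>t. (zero_count f c t - pole_count f c t) / t) = U r - U 1"
      by (subst integral_unique, assumption) (simp add: U_def L_def right_diff_distrib sum_subtractf)
    then have first: "\<bar>integral {1..r} (\<lambda>t. (zero_count f c t - pole_count f c t) / t)\<bar> < 2 * D + 1"
      using bU[of r] bU[of 1] r by auto
    let ?S = "\<Sum>a\<in>A. of_int (mord f a) * (a - c) * of_real (L a)"
    have "((\<lambda>t. \<Sum>a\<in>A. of_int (mord f a) * (a - c) * of_real (if cmod (a - c) < t then 1 / t else 0)) has_integral ?S) {1..r}"
      by (intro has_integral_sum fin has_integral_mult_right has_integral_of_real ind)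
    moreover have "(\<Sum>a\<in>A. of_int (mord f a) * (a - c) * of_real (if cmod (a - c) < t then 1 / t else 0)) = (zero_sum f c t - pole_sum f c t) / of_real t"
      if "t \<in> {1..r}" for t
      using that by (subst count_eq_sum(2)[OF f, of t "r + 1"]) (auto simp: A_def sum_divide_distrib intro!: sum.cong)
    ultimately have "((\<lambda>t. (zero_sum f c t - pole_sum f c t) / of_real t) has_integral ?S) {1..r}"
      by (rule has_integral_eq[rotated])
    then have S: "integral {1..r} (\<lambda>t. (zero_sum f c t - pole_sum f c t) / of_real t) = ?S"
      by (rule integral_unique)
    have "((\<lambda>t. t) has_integral (r\<^sup>2 / 2 - 1\<^sup>2 / 2)) {1..r}"
      using r by (intro fundamental_theorem_of_calculus)
        (auto intro!: derivative_eq_intros simp flip: has_real_derivative_iff_has_vector_derivative)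
    then have id: "((\<lambda>t. of_real t * q) has_integral of_real (r\<^sup>2 / 2 - 1 / 2) * q) {1..r}"
      by (intro has_integral_mult_left has_integral_of_real) simp
    have "((\<lambda>t. t / (max t (cmod (a - c)))\<^sup>2) has_integral L a + E a) {1..r}" for a
      using integral_div_max_square[of r "cmod (a - c)"] r by (simp add: L_def E_def algebra_simps)
    then have "((\<lambda>t. of_int (mord f a) * ((a - c) * of_real (t / (max t (cmod (a - c)))\<^sup>2))) has_integral
        of_int (mord f a) * ((a - c) * of_real (L a + E a))) {1..r}" for a
      by (intro has_integral_mult_right has_integral_of_real)
    then have intM: "(M has_integral of_real (r\<^sup>2 / 2 - 1 / 2) * q - (\<Sum>a\<in>A. of_int (mord f a) * ((a - c) * of_real (L a + E a)))) {1..r}"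
      unfolding M_def by (intro has_integral_diff id has_integral_sum fin)
    \<comment> \<open>Up to sign, \<open>E\<close> is the boundary part of t M t / 2, and the q-term
      here equals the integral of t q. Subtracting the integral of M removes both and leaves the sum
      with \<open>L\<close>, which is the second integral.\<close>
    have endp: "(of_real r * M r - M 1) / 2 = of_real (r\<^sup>2 / 2 - 1 / 2) * q - (\<Sum>a\<in>A. of_int (mord f a) * ((a - c) * of_real (E a)))"
    proof -
      have "(\<Sum>a\<in>A. of_int (mord f a) * ((a - c) * of_real (E a))) =
         of_real r / 2 * (\<Sum>a\<in>A. of_int (mord f a) * ((a - c) * of_real (r / (max r (cmod (a - c)))\<^sup>2)))
         - 1 / 2 * (\<Sum>a\<in>A. of_int (mord f a) * ((a - c) * of_real (1 / (max 1 (cmod (a - c)))\<^sup>2)))"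
        unfolding sum_distrib_left sum_subtractf[symmetric]
      proof (intro sum.cong refl)
        fix a
        have "of_real (E a) = of_real r / 2 * of_real (r / (max r (cmod (a - c)))\<^sup>2) - 1 / 2 * (of_real (1 / (max 1 (cmod (a - c)))\<^sup>2) :: complex)"
          by (simp add: E_def power2_eq_square)
        then show "of_int (mord f a) * ((a - c) * of_real (E a)) =
           of_real r / 2 * (of_int (mord f a) * ((a - c) * of_real (r / (max r (cmod (a - c)))\<^sup>2))) -
           1 / 2 * (of_int (mord f a) * ((a - c) * of_real (1 / (max 1 (cmod (a - c)))\<^sup>2)))"
          by (simp only: right_diff_distrib mult.left_commute)
      qed
      then show ?thesis
        by (simp add: M_def power2_eq_square algebra_simps add_divide_distrib diff_divide_distrib)
    qed
    have "(\<Sum>a\<in>A. of_int (mord f a) * ((a - c) * of_real (L a + E a))) =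
        ?S + (\<Sum>a\<in>A. of_int (mord f a) * ((a - c) * of_real (E a)))"
      by (simp add: distrib_left mult.assoc flip: sum.distrib)
    then have "?S = (of_real r * M r - M 1) / 2 - integral {1..r} M"
      unfolding endp integral_unique[OF intM] by simp
    then have "cmod ?S \<le> cmod ((of_real r * M r - M 1) / 2) + cmod (integral {1..r} M)"
      by (simp only: norm_triangle_ineq4)
    also have "cmod ((of_real r * M r - M 1) / 2) \<le> (r * D + D) / 2"
    proof -
      have "cmod (of_real r * M r - M 1) \<le> cmod (of_real r * M r) + cmod (M 1)" by (rule norm_triangle_ineq4)
      also have "\<dots> \<le> r * D + D" using bM[of r] bM[of 1] r by (intro add_mono) (auto simp: norm_mult)
      finally show ?thesis by (simp add: norm_divide)
    qed
    also have "cmod (integral {1..r} M) \<le> D * (r - 1)"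
    proof -
      have "cmod (integral {1..r} M) \<le> integral {1..r} (\<lambda>_. D)"
        using intM bM by (intro Henstock_Kurzweil_Integration.integral_norm_bound_integral) auto
      then show ?thesis using r by (simp add: mult.commute)
    qed
    finally have "cmod ?S \<le> (r * D + D) / 2 + D * (r - 1)" by simp
    \<comment> \<open>The left side is 3/2 r D - D/2; the growth in r is linear and is absorbed by
      the factor 1/r of the claim.\<close>
    also have "\<dots> \<le> r * (2 * D)"
      using r D0 mult_nonneg_nonneg[of r D] by (simp add: algebra_simps)
    also have "\<dots> < r * (2 * D + 1)" using r by simp
    finally have "cmod ((1 / of_real r) * ?S) < 2 * D + 1"
      using r by (simp add: norm_mult norm_divide pos_divide_less_eq mult.commute)
    with first show "\<bar>integral {1..r} (\<lambda>t. (zero_count f c t - pole_count f c t) / t)\<bar> < 2 * D + 1 \<and>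
     cmod ((1 / of_real r) * integral {1..r} (\<lambda>t. (zero_sum f c t - pole_sum f c t) / of_real t)) < 2 * D + 1"
      by (simp only: S)
  qed
qed

end
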